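(* For every sufficiently small $\epsilon>0$ there exists $r_\epsilon>0$ such that, for all sufficiently large $q\in\mathbb{N}$, $$\frac{1}{\Phi(q)}\#\left\{\frac pr\in\mathbb{Q}(q):\left|\frac{\ell(p/r)}{2\log r}-\frac{6\log2}{\pi^2}\right|\ge\epsilon\right\}\le q^{-2r_\epsilon}.$$
   Context: For $q\in\mathbb{N}$, $\mathbb{Q}(q)=\left\{\frac pr\in(0,1):1\le p<r\le q,\ \gcd(p,r)=1\right\}$ and $\Phi(q)=\#\mathbb{Q}(q)$. For a rational $x\in(0,1)$, $\ell(x)$ denotes the length of its (canonical) finite continued fraction expansion $x=[a_1,\ldots,a_{\ell(x)}]$; equivalently, the integer $\ell(x)\ge1$ with $G^{\ell(x)}(x)=0$ and $G^{\ell(x)-1}(x)>0$, where $G(x)=\frac1x-\lfloor\frac1x\rfloor$ is the Gauss map. *)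

theory Defs
  imports Complex_Main
begin

definition QQ :: "nat \<Rightarrow> rat set" where
  "QQ q = {of_nat p / of_nat r | p r. 1 \<le> p \<and> p < r \<and> r \<le> q \<and> coprime p r}"

definition Phi :: "nat \<Rightarrow> nat" where
  "Phi q = card (QQ q)"

text \<open>The denominator of a rational in lowest terms (always positive).\<close>
definition denom :: "rat \<Rightarrow> int" where
  "denom x = snd (quotient_of x)"

text \<open>Here \<^term>\<open>frac y\<close> is \<open>y - \<lfloor>y\<rfloor>\<close>; since \<open>1 / 0 = 0\<close>, the value at \<open>0\<close> is \<open>0\<close>.\<close>
definition gauss_map :: "rat \<Rightarrow> rat" where
  "gauss_map x = frac (1 / x)"

text \<open>Only meaningful for \<open>x\<close> in \<open>(0, 1)\<close>, where the number described exists and is unique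
  (lemma \<open>ex1_cf_length\<close>).\<close>
definition cf_length :: "rat \<Rightarrow> nat" where
  "cf_length x =
    (THE n. 1 \<le> n \<and> (gauss_map ^^ n) x = 0 \<and> (gauss_map ^^ (n - 1)) x > 0)"

lemma gauss_map_0 [simp]: "gauss_map 0 = 0"
  by (simp add: gauss_map_def)

lemma gauss_map_funpow_0 [simp]: "(gauss_map ^^ n) 0 = 0"
  by (induction n) simp_all

lemma gauss_map_bounds: "0 \<le> gauss_map x" "gauss_map x < 1"
  by (simp_all add: gauss_map_def frac_ge_0 frac_lt_1)

lemma gauss_map_of_nat_divide:
  assumes "0 < p"
  shows "gauss_map (of_nat p / of_nat r) = of_nat (r mod p) / of_nat p"
proof -
  have "(of_nat r :: rat) = of_nat (r div p) * of_nat p + of_nat (r mod p)"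
    by (metis div_mult_mod_eq of_nat_add of_nat_mult)
  then have eq: "(of_nat r / of_nat p :: rat) =
      of_int (int (r div p)) + of_nat (r mod p) / of_nat p"
    using assms by (simp add: field_simps)
  have "frac (of_nat (r mod p) / of_nat p :: rat) = of_nat (r mod p) / of_nat p"
    using assms by (simp add: frac_eq)
  then show ?thesis
    by (simp add: gauss_map_def eq frac_def)
qed

lemma ex1_cf_length:
  assumes "0 < x" "x < 1"
  shows "\<exists>!n. 1 \<le> n \<and> (gauss_map ^^ n) x = 0 \<and> (gauss_map ^^ (n - 1)) x > 0"
proof -
  have ex: "\<exists>n\<ge>1. (gauss_map ^^ n) (of_nat p / of_nat r) = 0 \<and>
      (gauss_map ^^ (n - 1)) (of_nat p / of_nat r) > 0" if "0 < p" "0 < r" for p r :: nat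
    using that
  proof (induction p arbitrary: r rule: less_induct)
    case (less p)
    note g = gauss_map_of_nat_divide[OF less.prems(1), of r]
    show ?case
    proof (cases "r mod p = 0")
      case True
      then show ?thesis
        using less.prems g by (intro exI[of _ 1]) simp
    next
      case False
      then obtain n where n: "n \<ge> 1" "(gauss_map ^^ n) (of_nat (r mod p) / of_nat p) = 0"
        "(gauss_map ^^ (n - 1)) (of_nat (r mod p) / of_nat p) > 0"
        using less.IH[of "r mod p" p] less.prems by auto
      then obtain m where "n = Suc m"
        by (cases n) auto
      then show ?thesis
        using n g by (intro exI[of _ "Suc n"]) (simp add: funpow_swap1)
    qed
  qed
  obtain a b where ab: "quotient_of x = (a, b)"
    by (cases "quotient_of x")
  have b: "b > 0" and xab: "x = of_int a / of_int b"
    using ab quotient_of_denom_pos quotient_of_div by auto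
  have a: "a > 0"
    using b xab assms(1) by (simp add: zero_less_divide_iff)
  have "x = of_nat (nat a) / of_nat (nat b)"
    using a b xab by simp
  then obtain n where n: "n \<ge> 1" "(gauss_map ^^ n) x = 0" "(gauss_map ^^ (n - 1)) x > 0"
    using ex[of "nat a" "nat b"] a b by auto
  have less: "l < k" if "(gauss_map ^^ l) x > 0" "(gauss_map ^^ k) x = 0" for k l
  proof (rule ccontr)
    assume "\<not> l < k"
    then have "(gauss_map ^^ l) x = (gauss_map ^^ (l - k)) ((gauss_map ^^ k) x)"
      by (metis comp_apply funpow_add le_add_diff_inverse2 not_less)
    then show False using that by simp
  qed
  show ?thesis
  proof (rule ex1I[of _ n])
    fix k assume k: "1 \<le> k \<and> (gauss_map ^^ k) x = 0 \<and> (gauss_map ^^ (k - 1)) x > 0"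
    show "k = n"
      using less[of "k - 1" n] less[of "n - 1" k] k n by linarith
  qed (use n in auto)
qed

end

theory Submission
  imports Defs "HOL-Analysis.Analysis" "HOL-Real_Asymp.Real_Asymp"
begin

text \<open>
  The proof is Chernoff's method applied to the length of the continued fraction expansion.
  Write \<open>h = \<pi>\<^sup>2 / (6 ln 2)\<close>, so that the claimed limit of \<open>\<ell>(x) / (2 ln r)\<close> is \<open>1 / h\<close>.
  Everything follows from one estimate on the rationals \<open>x\<close> of depth \<open>n\<close>, that is, those
  with \<open>\<ell>(x) = n\<close>, with denominators \<open>r(x)\<close>: for every \<open>\<eta> > 0\<close> and all \<open>t\<close> close to \<open>0\<close>, of
  either sign,

  \<open>\<Sum> r(x)\<^bsup>-2-2t\<^esup> \<le> 6 exp (n (- t h + \<eta> \<bar>t\<bar>))\<close>   (lemma \<open>cf_level_denom_sum\<close>).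

  Granting this, a fraction with denominator at most \<open>q\<close> satisfies \<open>1 \<le> (q / r)\<^bsup>2-2\<tau>\<^esup>\<close>.
  If its expansion is too long or too short for \<open>r\<close>, then \<open>r\<^bsup>2t+2\<tau>\<^esup>\<close> is at most
  \<open>exp (\<beta> \<ell>(x))\<close> for a suitable \<open>\<beta>\<close>. Summing over depths gives a geometric series
  with ratio \<open>exp (\<beta> - t h + \<eta> \<bar>t\<bar>)\<close>. It converges when \<open>t > 0\<close> is used for long expansions,
  \<open>t < 0\<close> for short ones, and \<open>\<eta>\<close>, \<open>\<tau>\<close> are small. So the exceptional set has at most
  \<open>C q\<^bsup>2-2\<tau>\<^esup>\<close> elements (lemmas \<open>long_expansions_rare\<close>, \<open>short_expansions_rare\<close>), while
  \<open>\<Phi>(q)\<close> is of order \<open>q\<^sup>2\<close> (lemma \<open>Phi_lower_bound\<close>).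

  For the estimate, prepending a digit to \<open>y\<close> gives a point \<open>x\<close> with \<open>r(x) = r(y) / x\<close>, so sums
  over depth \<open>n\<close> are bounded by the iterates, evaluated at \<open>0\<close>, of the operator that sends \<open>f\<close> to
  \<open>\<Sum>\<^sub>k (k+1+x)\<^bsup>-2-2t\<^esup> f(1/(k+1+x))\<close> (lemma \<open>cf_level_weighted_sum\<close>), and it suffices to exhibit a
  positive \<open>f\<close>, bounded above and below, that this operator multiplies by at most
  \<open>exp (- t h + \<eta> \<bar>t\<bar>)\<close>. At \<open>t = 0\<close> the Gauss density \<open>1 / (1 + x)\<close> is fixed. For small \<open>t\<close>
  take \<open>f = (1 + t u) / (1 + x)\<close>. Let \<open>P\<close> be the operator for \<open>t = 0\<close> normalised by the Gauss
  density, and \<open>\<phi>(y) = - 2 ln y\<close>. To first order in \<open>t\<close> the requirement on \<open>u\<close> is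
  \<open>u - P u + P \<phi> \<approx> h\<close>, and the first order decides, because the bound may lose
  \<open>\<eta> \<bar>t\<bar>\<close> and \<open>O(t\<^sup>2)\<close> is smaller than this.

  This Poisson equation is solved, up to a uniform error, by the finite sums of \<open>h - P\<^sup>j (P \<phi>)\<close>, as soon
  as \<open>P\<^sup>j (P \<phi>)\<close> converges to \<open>h\<close> uniformly. It does, since \<open>P\<close> contracts Lipschitz constants by
  \<open>26/27\<close> (lemma \<open>gk_op_lipschitz\<close>) and preserves the Gauss measure (lemma
  \<open>gauss_integral_gk_op\<close>), for which the mean of \<open>\<phi>\<close> is \<open>h\<close> (lemma \<open>gauss_integral_log\<close>).
\<close>

section \<open>The Gauss-Kuzmin operator and its contraction of Lipschitz functions\<close>

text \<open>
  The Gauss-Kuzmin transition probabilities: the probability, under the Gauss measure, that the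
  first digit is \<open>k + 1\<close> given that the remaining expansion is \<open>x\<close>. Digits are shifted by one so that sums
  run over all natural numbers.
\<close>
definition gk_weight :: "nat \<Rightarrow> real \<Rightarrow> real" where
  "gk_weight k x = (1 + x) / ((real k + 1 + x) * (real k + 2 + x))"

text \<open>
  The transfer operator of the Gauss map, normalised by the invariant density \<open>1 / (1 + x)\<close> so
  that constants are fixed.
\<close>
definition gk_op :: "(real \<Rightarrow> real) \<Rightarrow> real \<Rightarrow> real" where
  "gk_op v x = (\<Sum>k. gk_weight k x * v (1 / (real k + 1 + x)))"

lemma branch_mem:
  assumes "x \<in> {0..1::real}"
  shows "1 / (real k + 1 + x) \<in> {0..1}" "1 / (real k + 1 + x) > 0"
  using assms by (auto simp: field_simps)

lemma gk_weight_nonneg: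
  assumes "x \<ge> 0" shows "gk_weight k x \<ge> 0"
  using assms by (simp add: gk_weight_def)

text \<open>
  The sum telescopes. The remainder is the probability of a digit larger than \<open>n\<close>, and its
  monotonicity in \<open>x\<close> is what drives the contraction below.
\<close>
lemma gk_weight_partial_sum:
  assumes "x \<ge> 0"
  shows "(\<Sum>k<n. gk_weight k x) = 1 - (1 + x) / (real n + 1 + x)"
proof (induction n)
  case (Suc n)
  have "(1 + x) / ((real n + 1 + x) * (real n + 2 + x)) =
      (1 + x) / (real n + 1 + x) - (1 + x) / (real n + 2 + x)"
    using assms by (simp add: divide_simps) (simp add: algebra_simps)
  then show ?case
    using Suc by (simp add: gk_weight_def algebra_simps)
qed (use assms in simp)

lemma gk_weight_sums:
  assumes "x \<ge> 0"
  shows "(\<lambda>k. gk_weight k x) sums 1"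
proof -
  have "(\<lambda>n. 1 - (1 + x) / (real n + 1 + x)) \<longlonglongrightarrow> 1"
    by real_asymp
  then show ?thesis
    unfolding sums_def gk_weight_partial_sum[OF assms] .
qed

lemma gk_weight_le:
  assumes "x \<in> {0..1}"
  shows "gk_weight k x \<le> 2 / (real k + 1)\<^sup>2"
  unfolding gk_weight_def power2_eq_square
  using assms by (intro frac_le mult_mono) auto

lemma gk_op_summable:
  assumes "x \<in> {0..1}" and "\<And>y. y \<in> {0..1} \<Longrightarrow> \<bar>v y\<bar> \<le> B"
  shows "summable (\<lambda>k. gk_weight k x * v (1 / (real k + 1 + x)))"
proof (rule summable_comparison_test')
  show "summable (\<lambda>k. gk_weight k x * B)"
    using assms(1) sums_summable[OF gk_weight_sums] by (intro summable_mult2) auto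
  show "norm (gk_weight k x * v (1 / (real k + 1 + x))) \<le> gk_weight k x * B" if "k \<ge> 0" for k
    using assms(2)[OF branch_mem(1)[OF assms(1)]] gk_weight_nonneg[of x k] assms(1)
    by (auto simp: abs_mult intro!: mult_left_mono)
qed

lemma gk_op_const:
  assumes "x \<ge> 0" shows "gk_op (\<lambda>_. c) x = c"
  using sums_unique[OF sums_mult2[OF gk_weight_sums[OF assms], of c]] by (simp add: gk_op_def)

lemma gk_op_lincomb:
  assumes "x \<in> {0..1}" "\<And>y. y \<in> {0..1} \<Longrightarrow> \<bar>v y\<bar> \<le> B" "\<And>y. y \<in> {0..1} \<Longrightarrow> \<bar>w y\<bar> \<le> C"
  shows "gk_op (\<lambda>y. a * v y + b * w y) x = a * gk_op v x + b * gk_op w x"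
proof -
  note s = gk_op_summable[where v = v, OF assms(1,2)] gk_op_summable[where v = w, OF assms(1,3)]
  have "gk_op (\<lambda>y. a * v y + b * w y) x =
     (\<Sum>k. a * (gk_weight k x * v (1 / (real k + 1 + x))) + b * (gk_weight k x * w (1 / (real k + 1 + x))))"
    unfolding gk_op_def by (intro suminf_cong) (simp add: algebra_simps)
  also have "\<dots> = (\<Sum>k. a * (gk_weight k x * v (1 / (real k + 1 + x)))) + (\<Sum>k. b * (gk_weight k x * w (1 / (real k + 1 + x))))"
    using s by (intro suminf_add[symmetric] summable_mult) auto
  also have "\<dots> = a * gk_op v x + b * gk_op w x"
    using s by (simp add: suminf_mult gk_op_def)
  finally show ?thesis .
qed

text \<open>
  Summation by parts in the form needed for comparing two distributions on the naturals: when
  \<open>c\<close> is the first minus the second, nonnegative partial sums mean that the second one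
  stochastically dominates.
\<close>
lemma abel_sum_lower:
  fixes b c :: "nat \<Rightarrow> real"
  assumes "\<And>n. (\<Sum>k<n. c k) \<ge> 0" "\<And>n. b (Suc n) \<le> b n"
  shows "(\<Sum>k<n. c k) * b n \<le> (\<Sum>k<n. c k * b k)"
proof (induction n)
  case (Suc n)
  have "(\<Sum>k<Suc n. c k) * b (Suc n) \<le> (\<Sum>k<Suc n. c k) * b n"
    by (intro mult_left_mono assms)
  also have "\<dots> \<le> (\<Sum>k<Suc n. c k * b k)"
    using Suc by (simp add: algebra_simps)
  finally show ?case .
qed simp

lemma mono_on_imp_bounded:
  fixes w :: "real \<Rightarrow> real"
  assumes "mono_on {0..1} w" "y \<in> {0..1}"
  shows "\<bar>w y\<bar> \<le> \<bar>w 0\<bar> + \<bar>w 1\<bar>"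
  using mono_onD[OF assms(1), of 0 y] mono_onD[OF assms(1), of y 1] assms(2) by auto

text \<open>
  Raising \<open>x\<close> has two effects, and both lower the average of an increasing \<open>w\<close>: each point \<open>1 / (k + 1 + x)\<close> moves
  left, and the digit distribution moves stochastically towards large digits, that is, towards
  small points.
\<close>
lemma gk_op_antimono:
  assumes w: "mono_on {0..1} w" and xy: "0 \<le> x" "x \<le> y" "y \<le> 1"
  shows "gk_op w y \<le> gk_op w x"
proof -
  \<comment> \<open>Subtracting \<open>w 0\<close> makes the sequence nonnegative and changes nothing, as \<open>c\<close> sums to \<open>0\<close>.\<close>
  define b where "b = (\<lambda>k. w (1 / (real k + 1 + x)) - w 0)"
  define c where "c = (\<lambda>k. gk_weight k x - gk_weight k y)"
  have mem: "1 / (real k + 1 + x) \<in> {0..1}" "1 / (real k + 1 + y) \<in> {0..1}" for k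
    using xy by (auto simp: field_simps)
  have bd: "\<bar>w z\<bar> \<le> \<bar>w 0\<bar> + \<bar>w 1\<bar>" if "z \<in> {0..1}" for z
    using mono_on_imp_bounded[OF w that] .
  have bdx: "\<bar>w (1 / (real k + 1 + x))\<bar> \<le> \<bar>w 0\<bar> + \<bar>w 1\<bar>" for k
    using bd mem by blast
  have sx: "summable (\<lambda>k. gk_weight k x * w (1 / (real k + 1 + x)))"
    and sy: "summable (\<lambda>k. gk_weight k y * w (1 / (real k + 1 + y)))"
    using xy by (auto intro!: gk_op_summable bd)
  have sm: "summable (\<lambda>k. gk_weight k y * w (1 / (real k + 1 + x)))"
  proof (rule summable_comparison_test')
    show "summable (\<lambda>k. gk_weight k y * (\<bar>w 0\<bar> + \<bar>w 1\<bar>))"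
      using xy sums_summable[OF gk_weight_sums] by (intro summable_mult2) auto
    show "norm (gk_weight k y * w (1 / (real k + 1 + x))) \<le> gk_weight k y * (\<bar>w 0\<bar> + \<bar>w 1\<bar>)" for k
      using bdx[of k] gk_weight_nonneg[of y k] xy by (auto simp: abs_mult intro!: mult_left_mono)
  qed
  have cpos: "(\<Sum>k<n. c k) \<ge> 0" for n
  proof -
    have "(\<Sum>k<n. c k) = (1 + y) / (real n + 1 + y) - (1 + x) / (real n + 1 + x)"
      using xy by (simp add: c_def sum_subtractf gk_weight_partial_sum)
    also have "\<dots> \<ge> 0"
    proof -
      have "real n * x \<le> real n * y" using xy by (intro mult_left_mono) auto
      then show ?thesis using xy by (simp add: divide_simps) (simp add: algebra_simps)
    qed
    finally show ?thesis .
  qed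
  have bdec: "b (Suc n) \<le> b n" for n
  proof -
    have "1 / (real (Suc n) + 1 + x) \<le> 1 / (real n + 1 + x)"
      using xy by (auto simp: field_simps)
    from mono_onD[OF w mem(1) mem(1) this] show ?thesis by (simp add: b_def)
  qed
  have bpos: "b n \<ge> 0" for n
    using mono_onD[OF w _ mem(1), of 0 n] mem(1)[of n] by (auto simp: b_def)
  have csum: "c sums 0"
    unfolding c_def using sums_diff[OF gk_weight_sums[of x] gk_weight_sums[of y]] xy by simp
  have "gk_op w y \<le> (\<Sum>k. gk_weight k y * w (1 / (real k + 1 + x)))"
    unfolding gk_op_def
  proof (intro suminf_le sy sm mult_left_mono)
    fix k
    show "gk_weight k y \<ge> 0" using xy gk_weight_nonneg by simp
    have "1 / (real k + 1 + y) \<le> 1 / (real k + 1 + x)"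
      using xy by (auto simp: field_simps)
    from mono_onD[OF w mem(2) mem(1) this]
    show "w (1 / (real k + 1 + y)) \<le> w (1 / (real k + 1 + x))" .
  qed
  also have "\<dots> \<le> gk_op w x"
  proof -
    have eq: "c k * b k + c k * w 0 = gk_weight k x * w (1 / (real k + 1 + x)) - gk_weight k y * w (1 / (real k + 1 + x))" for k
      by (simp add: b_def c_def algebra_simps)
    have "(\<lambda>k. c k * b k + c k * w 0) sums (gk_op w x - (\<Sum>k. gk_weight k y * w (1 / (real k + 1 + x))))"
      unfolding eq gk_op_def using sx sm by (intro sums_diff summable_sums)
    from sums_diff[OF this sums_mult2[OF csum, of "w 0"]]
    have "(\<lambda>k. c k * b k) sums (gk_op w x - (\<Sum>k. gk_weight k y * w (1 / (real k + 1 + x))))"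
      by simp
    then have "(\<lambda>n. \<Sum>k<n. c k * b k) \<longlonglongrightarrow> gk_op w x - (\<Sum>k. gk_weight k y * w (1 / (real k + 1 + x)))"
      by (simp add: sums_def)
    moreover have "(\<Sum>k<n. c k * b k) \<ge> 0" for n
      using abel_sum_lower[of c b n, OF cpos bdec] mult_nonneg_nonneg[OF cpos[of n] bpos[of n]] by linarith
    ultimately show ?thesis
      using LIMSEQ_le_const[of _ _ 0] by fastforce
  qed
  finally show ?thesis .
qed

text \<open>
  Partial fractions turn the operator applied to the identity into
  \<open>(1 + x) \<Sum>\<^sub>k (k + 1 + x)\<^sup>-\<^sup>2 - 1\<close>. From the fourth summand on, the terms increase with \<open>x\<close>
  and can be dropped from an upper bound of the decrease; the first three have a derivative that is
  smallest at \<open>0\<close>, where it equals \<open>-1 + 1/27\<close>.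
\<close>
lemma gk_op_id_contraction:
  assumes xy: "0 \<le> x" "x \<le> y" "y \<le> 1"
  shows "gk_op (\<lambda>z. z) x - gk_op (\<lambda>z. z) y \<le> 26/27 * (y - x)"
proof -
  define T where "T = (\<lambda>k z::real. (1 + z) / (real k + 1 + z)\<^sup>2)"
  have split: "gk_weight k z * (1 / (real k + 1 + z)) = T k z - gk_weight k z" if "z \<ge> 0" for k z
  proof -
    have [simp]: "real k + 1 + z \<noteq> 0" "real k + 2 + z \<noteq> 0"
      using that by linarith+
    show ?thesis unfolding gk_weight_def T_def power2_eq_square
      by (simp add: divide_simps) algebra
  qed
  have bnd: "\<bar>z\<bar> \<le> 1" if "z \<in> {0..1::real}" for z
    using that by auto
  have sums: "T' sums (gk_op (\<lambda>z. z) z + 1)" if "T' = (\<lambda>k. T k z)" "z \<in> {0..1}" for z T'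
  proof -
    have "(\<lambda>k. gk_weight k z * (1 / (real k + 1 + z)) + gk_weight k z) sums (gk_op (\<lambda>z. z) z + 1)"
      unfolding gk_op_def using that
      by (intro sums_add summable_sums gk_op_summable[where v = "\<lambda>z. z", OF _ bnd] gk_weight_sums) auto
    then show ?thesis using split that by simp
  qed
  have tail: "T k x \<le> T k y" if "k \<ge> 3" for k
  proof -
    have "(1 + x) * (real k + 1 + y)\<^sup>2 \<le> (1 + y) * (real k + 1 + x)\<^sup>2"
    proof -
      have "(1 + y) * (real k + 1 + x)\<^sup>2 - (1 + x) * (real k + 1 + y)\<^sup>2 = (y - x) * ((real k)\<^sup>2 - (1+x)*(1+y))"
        by (simp add: power2_eq_square algebra_simps)
      moreover have "(1+x)*(1+y) \<le> 2 * (2::real)"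
        using xy by (intro mult_mono) auto
      moreover have "(real k)\<^sup>2 \<ge> 3\<^sup>2"
        using that by (intro power_mono) auto
      ultimately have "0 \<le> (1 + y) * (real k + 1 + x)\<^sup>2 - (1 + x) * (real k + 1 + y)\<^sup>2"
        using xy by (auto intro!: mult_nonneg_nonneg)
      then show ?thesis by linarith
    qed
    then show ?thesis
      unfolding T_def using xy by (simp add: divide_simps mult.commute)
  qed
  have d: "(\<lambda>k. T k y - T k x) sums (gk_op (\<lambda>z. z) y - gk_op (\<lambda>z. z) x)"
    using sums_diff[OF sums[OF refl, of y] sums[OF refl, of x]] xy by simp
  have "(\<Sum>k<3. T k y - T k x) \<le> (\<Sum>k. T k y - T k x)"
    using d tail by (intro sum_le_suminf) (auto simp: sums_iff)
  then have le: "gk_op (\<lambda>z. z) x - gk_op (\<lambda>z. z) y \<le> (\<Sum>k<3. T k x - T k y)"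
    using d by (simp add: sums_iff sum_subtractf)
  \<comment> \<open>Linear bounds on each of the three derivatives, exact at \<open>z = 0\<close>, show that \<open>F\<close> increases.\<close>
  define F where "F = (\<lambda>z::real. (1 + z) / (1 + z)\<^sup>2 + (1 + z) / (2 + z)\<^sup>2 + (1 + z) / (3 + z)\<^sup>2 + 26/27 * z)"
  have "F x \<le> F y"
  proof (rule DERIV_nonneg_imp_nondecreasing[OF xy(2)])
    fix z assume z: "x \<le> z" "z \<le> y"
    then have z01: "0 \<le> z" "z \<le> 1" using xy by auto
    have quot: "((\<lambda>z. (1 + z) / (c + z)\<^sup>2) has_real_derivative (c - 2 - z) / (c + z)^3) (at z)"
      if "c > 0" for c :: real
    proof -
      have ne: "c + z \<noteq> 0" using that z01 by simp
      have "((\<lambda>z. (1 + z) / (c + z)\<^sup>2) has_real_derivative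
          ((c + z)\<^sup>2 - (1 + z) * (2 * (c + z))) / ((c + z)\<^sup>2 * (c + z)\<^sup>2)) (at z)"
        using ne by (auto intro!: derivative_eq_intros simp: power2_eq_square)
      also have "(c + z)\<^sup>2 - (1 + z) * (2 * (c + z)) = (c + z) * (c - 2 - z)"
        by (simp add: power2_eq_square algebra_simps)
      also have "(c + z) * (c - 2 - z) / ((c + z)\<^sup>2 * (c + z)\<^sup>2) = (c - 2 - z) / (c + z)^3"
        using ne by (simp add: divide_simps power2_eq_square power3_eq_cube)
      finally show ?thesis .
    qed
    have "(F has_real_derivative ((1 - 2 - z)/(1+z)^3 + (2 - 2 - z) / (2+z)^3 + (3 - 2 - z)/(3+z)^3 + 26/27)) (at z)"
      unfolding F_def by (intro DERIV_add quot) (auto intro!: derivative_eq_intros)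
    moreover have "(1 - 2 - z)/(1+z)^3 + (2 - 2 - z) / (2+z)^3 + (3 - 2 - z)/(3+z)^3 + 26/27 \<ge> 0"
    proof -
      have "0 \<le> z * (1 - z) * (5 + 3 * z)" using z01 by simp
      then have "(1+z)^2 * (1 - 3/4 * z) \<ge> 1"
        using z01 by (simp add: power2_eq_square algebra_simps)
      then have "1 - 3/4 * z \<ge> 1 / (1+z)^2"
        using z01 by (simp add: field_simps)
      also have "1 / (1+z)^2 = - ((1 - 2 - z)/(1+z)^3)"
        using z01 by (simp add: divide_simps power2_eq_square power3_eq_cube)
      finally have 1: "(1 - 2 - z)/(1+z)^3 \<ge> 3/4 * z - 1" by simp
      have "z / (2+z)^3 \<le> z / 2^3"
        using z01 by (intro divide_left_mono power_mono mult_pos_pos) auto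
      then have 2: "(2 - 2 - z) / (2+z)^3 \<ge> - z / 8" by simp
      have "(1 - z) * (3 + z)^3 \<le> 27"
      proof -
        have "27 - (1 - z) * (3 + z)^3 = z^2 * (18 + 8 * z + z^2)"
          by (simp add: power2_eq_square power3_eq_cube algebra_simps)
        then show ?thesis using z01 by (smt (verit) mult_nonneg_nonneg zero_le_power2)
      qed
      then have "(1 - z) / 27 \<le> 1 / (3 + z)^3"
        using z01 by (simp add: field_simps)
      then have "(1 - z) * ((1 - z) / 27) \<le> (1 - z) * (1 / (3 + z)^3)"
        using z01 by (intro mult_left_mono) auto
      moreover have "(1 - z) * ((1 - z) / 27) = (1 - 2 * z) / 27 + z\<^sup>2 / 27"
        by (simp add: power2_eq_square field_simps)
      moreover have "(1 - z) * (1 / (3 + z)^3) = (3 - 2 - z) / (3 + z)^3" by simp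
      ultimately have 3: "(3 - 2 - z)/(3+z)^3 \<ge> (1 - 2 * z) / 27"
        using zero_le_power2[of z] by linarith
      have "0 \<le> a + b + c + 26/27"
        if "3/4 * z - 1 \<le> a" "- z / 8 \<le> b" "(1 - 2 * z) / 27 \<le> c" for a b c
        using that z01 unfolding diff_divide_distrib by linarith
      from this[OF 1 2 3] show ?thesis .
    qed
    ultimately show "\<exists>y. DERIV F z :> y \<and> y \<ge> 0" by blast
  qed
  then show ?thesis using le by (simp add: F_def T_def eval_nat_numeral algebra_simps)
qed

text \<open>
  If \<open>v\<close> is \<open>M\<close>-Lipschitz then both \<open>M z + v z\<close> and \<open>M z - v z\<close> increase with \<open>z\<close>, so
  antitonicity bounds the variation of the image of \<open>v\<close> by \<open>M\<close> times that of the image of the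
  identity.
\<close>
lemma gk_op_lipschitz:
  assumes v: "M-lipschitz_on {0..1} v"
  shows "(26/27 * M)-lipschitz_on {0..1} (gk_op v)"
proof -
  have M: "M \<ge> 0" using lipschitz_on_nonneg[OF v] .
  have vd: "\<bar>v x - v y\<bar> \<le> M * (y - x)" if "0 \<le> x" "x \<le> y" "y \<le> 1" for x y
    using lipschitz_onD[OF v, of x y] that by (simp add: dist_real_def)
  have vb: "\<bar>v y\<bar> \<le> \<bar>v 0\<bar> + M" if "y \<in> {0..1}" for y
    using vd[of 0 y] that mult_left_mono[of y 1 M] M by auto
  have idb: "\<bar>y\<bar> \<le> 1" if "y \<in> {0..1::real}" for y using that by auto
  have key: "\<bar>gk_op v x - gk_op v y\<bar> \<le> 26/27 * M * (y - x)" if "0 \<le> x" "x \<le> y" "y \<le> 1" for x y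
  proof -
    have "gk_op (\<lambda>z. M * z + s * v z) y \<le> gk_op (\<lambda>z. M * z + s * v z) x" if "s = 1 \<or> s = -1" for s
    proof (rule gk_op_antimono)
      show "mono_on {0..1} (\<lambda>z. M * z + s * v z)"
      proof (rule mono_onI)
        fix a b :: real assume "a \<in> {0..1}" "b \<in> {0..1}" "a \<le> b"
        then show "M * a + s * v a \<le> M * b + s * v b"
          using that vd[of a b] by (auto simp: algebra_simps abs_le_iff)
      qed
    qed fact+
    then have *: "M * gk_op (\<lambda>z. z) y + s * gk_op v y \<le> M * gk_op (\<lambda>z. z) x + s * gk_op v x" if "s = 1 \<or> s = -1" for s
      using that \<open>0 \<le> x\<close> \<open>x \<le> y\<close> \<open>y \<le> 1\<close> 
      by (subst (asm) (1 2) gk_op_lincomb[where v = "\<lambda>z. z" and w = v, OF _ idb vb]) auto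
    have "\<bar>gk_op v x - gk_op v y\<bar> \<le> M * (gk_op (\<lambda>z. z) x - gk_op (\<lambda>z. z) y)"
      using *[of 1] *[of "-1"] by (auto simp: algebra_simps abs_le_iff)
    also have "\<dots> \<le> M * (26/27 * (y - x))"
      using gk_op_id_contraction[OF that] M by (intro mult_left_mono)
    finally show ?thesis by (simp add: algebra_simps)
  qed
  show ?thesis
  proof (rule lipschitz_onI)
    fix x y :: real assume "x \<in> {0..1}" "y \<in> {0..1}"
    then show "dist (gk_op v x) (gk_op v y) \<le> 26/27 * M * dist x y"
      using key[of x y] key[of y x] by (cases "x \<le> y") (auto simp: dist_real_def abs_minus_commute)
  qed (use M in simp)
qed

section \<open>The logarithm becomes Lipschitz after one step\<close>

lemma summable_powr_three_halves: "summable (\<lambda>k. (real k + 1) powr (-3/2))"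
proof -
  have "summable (\<lambda>n. real n powr (-3/2))"
    by (subst summable_real_powr_iff) simp
  from summable_Suc_iff[of "\<lambda>n. real n powr (-3/2)", THEN iffD2, OF this]
  show ?thesis by (simp add: add.commute)
qed

text \<open>
  A crude bound that makes every series below comparable with \<open>\<Sum>\<^sub>k (k + 1)\<^bsup>-3/2\<^esup>\<close>.
\<close>
lemma ln_le_three_sqrt:
  assumes "x \<in> {0..1::real}"
  shows "0 \<le> ln (real k + 1 + x)" "ln (real k + 1 + x) \<le> 3 * (real k + 1) powr (1/2)"
proof -
  show "0 \<le> ln (real k + 1 + x)" using assms by simp
  have "ln (real k + 1 + x) = 2 * ln ((real k + 1 + x) powr (1/2))"
    using assms by (simp add: ln_powr)
  also have "\<dots> \<le> 2 * ((real k + 1 + x) powr (1/2) - 1)"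
    using assms by (intro mult_left_mono ln_le_minus_one) auto
  also have "\<dots> \<le> 2 * (real k + 1 + x) powr (1/2)" by simp
  also have "\<dots> \<le> 2 * ((9/4) * (real k + 1)) powr (1/2)"
    using assms by (intro mult_left_mono powr_mono2) auto
  also have "\<dots> = 3 * (real k + 1) powr (1/2)"
    by (subst powr_mult) (auto simp: powr_half_sqrt real_sqrt_divide)
  finally show "ln (real k + 1 + x) \<le> 3 * (real k + 1) powr (1/2)" .
qed

lemma divide_square_eq_powr:
  "(real k + 1) powr (1/2) / (real k + 1)\<^sup>2 = (real k + 1) powr (-3/2)"
proof -
  have "(real k + 1) powr (1/2) / (real k + 1) powr 2 = (real k + 1) powr (-3/2)"
    by (subst powr_diff[symmetric]) simp
  then show ?thesis by (simp add: powr_realpow)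
qed

lemma inverse_square_le_powr: "1 / (real k + 1)\<^sup>2 \<le> (real k + 1) powr (-3/2)"
  unfolding divide_square_eq_powr[symmetric] by (intro divide_right_mono ge_one_powr_ge_zero) auto

text \<open>
  As \<open>gk_weight k x = a / (a + 1 + x) - (a - 1) / (a + x)\<close> with \<open>a = k + 1\<close>, the leading parts of
  the two difference quotients cancel, which leaves \<open>O(a\<^sup>-\<^sup>2)\<close>. Without the cancellation the bound
  would only be \<open>O(a\<^sup>-\<^sup>1)\<close> and the logarithmic series would diverge.
\<close>
lemma gk_weight_diff:
  assumes "x \<in> {0..1}" "y \<in> {0..1}"
  shows "\<bar>gk_weight k x - gk_weight k y\<bar> \<le> 3 / (real k + 1)\<^sup>2 * \<bar>x - y\<bar>"
proof -
  define a where "a = real k + 1"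
  have a: "a \<ge> 1" by (simp add: a_def)
  have w: "gk_weight k z = a / (a + 1 + z) - (a - 1) / (a + z)" if "z \<ge> 0" for z
    using that a unfolding gk_weight_def a_def by (simp add: divide_simps) (simp add: algebra_simps)
  define q where "q = (2 * a + 1 + x + y) / ((a + 1 + x) * (a + 1 + y) * ((a + x) * (a + y)))"
  define p where "p = a * q"
  define r where "r = 1 / ((a + x) * (a + y))"
  have eq: "gk_weight k x - gk_weight k y = (y - x) * (r - p)"
  proof -
    have ne: "a + 1 + x \<noteq> 0" "a + 1 + y \<noteq> 0" "a + x \<noteq> 0" "a + y \<noteq> 0" using assms a by auto
    have "gk_weight k x - gk_weight k y = a * (1 / (a + 1 + x) - 1 / (a + 1 + y)) - (a - 1) * (1 / (a + x) - 1 / (a + y))"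
      using assms by (simp add: w algebra_simps)
    also have "1 / (a + 1 + x) - 1 / (a + 1 + y) = (y - x) * (1 / ((a + 1 + x) * (a + 1 + y)))"
      using ne by (simp add: divide_simps)
    also have "1 / (a + x) - 1 / (a + y) = (y - x) * r"
      using ne by (simp add: r_def divide_simps)
    also have "1 / ((a + 1 + x) * (a + 1 + y)) = r - q"
      unfolding r_def q_def using ne a by (simp add: divide_simps) (simp add: algebra_simps)
    finally show ?thesis by (simp add: p_def algebra_simps)
  qed
  have r: "0 \<le> r" "r \<le> 1 / a\<^sup>2"
    unfolding r_def power2_eq_square using assms a by (auto intro!: frac_le mult_mono)
  have "p \<le> a * (3 * (a + 1) / ((a + 1) * (a + 1) * (a * a)))"
    unfolding p_def q_def using assms a by (intro mult_left_mono frac_le mult_mono) auto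
  also have "\<dots> = 3 / (a * (a + 1))" using a by (simp add: divide_simps)
  also have "\<dots> \<le> 3 / a\<^sup>2" unfolding power2_eq_square using a by (intro frac_le mult_mono) auto
  finally have p: "p \<le> 3 / a\<^sup>2" .
  have p0: "p \<ge> 0" unfolding p_def q_def using assms a by auto
  have "1 / a\<^sup>2 \<le> 3 / a\<^sup>2" by (intro divide_right_mono) auto
  then have "\<bar>r - p\<bar> \<le> 3 / a\<^sup>2" using r p p0 by (auto simp: abs_le_iff)
  then have "\<bar>y - x\<bar> * \<bar>r - p\<bar> \<le> \<bar>y - x\<bar> * (3 / a\<^sup>2)" by (intro mult_left_mono) auto
  then show ?thesis unfolding eq a_def by (simp add: abs_mult mult.commute abs_minus_commute)
qed

lemma gk_op_log_term:
  assumes "x \<in> {0..1}"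
  shows "-2 * ln (1 / (real k + 1 + x)) = 2 * ln (real k + 1 + x)"
  using assms by (simp add: ln_div)

lemma gk_op_log_summable:
  assumes x: "x \<in> {0..1}"
  shows "summable (\<lambda>k. gk_weight k x * (- 2 * ln (1 / (real k + 1 + x))))"
proof (rule summable_comparison_test')
  show "summable (\<lambda>k. 12 * (real k + 1) powr (-3/2))"
    by (intro summable_mult summable_powr_three_halves)
  fix k
  have "gk_weight k x * (2 * ln (real k + 1 + x)) \<le> 2 / (real k + 1)\<^sup>2 * (2 * (3 * (real k + 1) powr (1/2)))"
    using ln_le_three_sqrt[OF x, of k] gk_weight_nonneg[of x k] gk_weight_le[OF x, of k] x
    by (intro mult_mono) auto
  also have "\<dots> = 12 * (real k + 1) powr (-3/2)"
    by (subst divide_square_eq_powr[symmetric]) simp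
  finally show "norm (gk_weight k x * (- 2 * ln (1 / (real k + 1 + x)))) \<le> 12 * (real k + 1) powr (-3/2)"
    using gk_weight_nonneg[of x k] ln_le_three_sqrt(1)[OF x, of k] x
    unfolding gk_op_log_term[OF x] by (simp add: abs_mult)
qed

text \<open>
  The function \<open>- 2 ln\<close> is unbounded at \<open>0\<close>, but one application of the operator averages the
  singularity away.
\<close>
lemma gk_op_log_lipschitz:
  "(22 * (\<Sum>k. (real k + 1) powr (-3/2)))-lipschitz_on {0..1} (gk_op (\<lambda>y. - 2 * ln y))"
proof (rule lipschitz_onI)
  fix x y :: real assume x: "x \<in> {0..1}" and y: "y \<in> {0..1}"
  define g where "g = (\<lambda>z k. gk_weight k z * (- 2 * ln (1 / (real k + 1 + z))))"
  have sg: "summable (g z)" if "z \<in> {0..1}" for z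
    unfolding g_def using gk_op_log_summable[OF that] .
  have bound: "\<bar>g x k - g y k\<bar> \<le> 22 * (real k + 1) powr (-3/2) * \<bar>x - y\<bar>" for k
  proof -
    have "g x k - g y k = (gk_weight k x - gk_weight k y) * (2 * ln (real k + 1 + x))
        + gk_weight k y * (2 * (ln (real k + 1 + x) - ln (real k + 1 + y)))"
      unfolding g_def gk_op_log_term[OF x] gk_op_log_term[OF y] by (simp add: algebra_simps)
    then have "\<bar>g x k - g y k\<bar> \<le> \<bar>(gk_weight k x - gk_weight k y) * (2 * ln (real k + 1 + x))\<bar>
        + \<bar>gk_weight k y * (2 * (ln (real k + 1 + x) - ln (real k + 1 + y)))\<bar>"
      by (simp only: abs_triangle_ineq)
    also have "\<dots> = \<bar>gk_weight k x - gk_weight k y\<bar> * (2 * ln (real k + 1 + x))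
        + gk_weight k y * (2 * \<bar>ln (real k + 1 + x) - ln (real k + 1 + y)\<bar>)"
      unfolding abs_mult using ln_le_three_sqrt(1)[OF x, of k] gk_weight_nonneg[of y k] y by simp
    also have "\<dots> \<le> (3 / (real k + 1)\<^sup>2 * \<bar>x - y\<bar>) * (2 * (3 * (real k + 1) powr (1/2)))
        + 2 / (real k + 1)\<^sup>2 * (2 * \<bar>x - y\<bar>)"
    proof (intro add_mono mult_mono)
      have lnle: "ln (real k + 1 + u) - ln (real k + 1 + v) \<le> \<bar>u - v\<bar>" if "u \<ge> 0" "v \<ge> 0" for u v
      proof -
        have "ln (real k + 1 + u) - ln (real k + 1 + v) = ln ((real k + 1 + u) / (real k + 1 + v))"
          using that by (simp add: ln_div)
        also have "\<dots> \<le> (real k + 1 + u) / (real k + 1 + v) - 1"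
          using that by (intro ln_le_minus_one) auto
        also have "\<dots> = (u - v) / (real k + 1 + v)"
          using that by (simp add: field_simps)
        also have "\<dots> \<le> \<bar>u - v\<bar> / 1"
          using that by (intro frac_le) auto
        finally show ?thesis by simp
      qed
      show "\<bar>ln (real k + 1 + x) - ln (real k + 1 + y)\<bar> \<le> \<bar>x - y\<bar>"
        using lnle[of x y] lnle[of y x] x y by (auto simp: abs_le_iff abs_minus_commute)
    qed (use x y gk_weight_diff[OF x y] gk_weight_nonneg[of y k] gk_weight_le[OF y] ln_le_three_sqrt[OF x, of k] in auto)
    also have "\<dots> = (18 * ((real k + 1) powr (1/2) / (real k + 1)\<^sup>2) + 4 * (1 / (real k + 1)\<^sup>2)) * \<bar>x - y\<bar>"
      by (simp add: algebra_simps)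
    also have "\<dots> \<le> (18 * (real k + 1) powr (-3/2) + 4 * (real k + 1) powr (-3/2)) * \<bar>x - y\<bar>"
      unfolding divide_square_eq_powr
      by (intro mult_right_mono add_mono mult_left_mono inverse_square_le_powr) auto
    finally show ?thesis by simp
  qed
  have sb: "summable (\<lambda>k. 22 * (real k + 1) powr (-3/2) * \<bar>x - y\<bar>)"
    by (intro summable_mult2 summable_mult summable_powr_three_halves)
  have sd: "summable (\<lambda>k. \<bar>g x k - g y k\<bar>)"
    by (rule summable_comparison_test'[OF sb]) (use bound in auto)
  have "dist (gk_op (\<lambda>y. - 2 * ln y) x) (gk_op (\<lambda>y. - 2 * ln y) y) = \<bar>\<Sum>k. g x k - g y k\<bar>"
    unfolding dist_real_def gk_op_def g_def[symmetric]
    using suminf_diff[OF sg[OF x] sg[OF y]] by (simp add: g_def)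
  also have "\<dots> \<le> (\<Sum>k. \<bar>g x k - g y k\<bar>)"
    by (rule summable_rabs[OF sd])
  also have "\<dots> \<le> (\<Sum>k. 22 * (real k + 1) powr (-3/2) * \<bar>x - y\<bar>)"
    using bound sd sb by (intro suminf_le)
  also have "\<dots> = 22 * (\<Sum>k. (real k + 1) powr (-3/2)) * dist x y"
    using summable_powr_three_halves
    by (simp add: dist_real_def suminf_mult suminf_mult2[symmetric] summable_mult)
  finally show "dist (gk_op (\<lambda>y. - 2 * ln y) x) (gk_op (\<lambda>y. - 2 * ln y) y)
    \<le> 22 * (\<Sum>k. (real k + 1) powr (-3/2)) * dist x y" .
qed (intro mult_nonneg_nonneg suminf_nonneg summable_powr_three_halves, simp_all)

section \<open>Invariance of the Gauss measure and the integral of the logarithm\<close>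

text \<open>
  The integral against the unnormalised Gauss measure. Values in \<^typ>\<open>ennreal\<close> allow sums and
  integrals to be exchanged freely, and only nonnegative functions are integrated.
\<close>
definition gauss_integral :: "(real \<Rightarrow> real) \<Rightarrow> ennreal" where
  "gauss_integral v = (\<integral>\<^sup>+x. ennreal (v x / (1 + x)) * indicator {0<..1} x \<partial>lborel)"

text \<open>
  The change of variables \<open>x \<mapsto> 1 / (k + 1 + x)\<close>, which maps the unit interval onto the cell of points
  with first digit \<open>k + 1\<close>.
\<close>
lemma gauss_integral_branch:
  assumes v[measurable]: "v \<in> borel_measurable borel"
  shows "(\<integral>\<^sup>+x. ennreal (v (1 / (real k + 1 + x)) / ((real k + 1 + x) * (real k + 2 + x))) * indicator {0<..1} x \<partial>lborel)
    = (\<integral>\<^sup>+x. ennreal (v x / (1 + x)) * indicator {1 / (real k + 2)<..1 / (real k + 1)} x \<partial>lborel)"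
proof -
  define f where "f = (\<lambda>z. v (- z) / (1 - z))"
  \<comment> \<open>The branch is reflected at \<open>0\<close> because substitution is for increasing maps.\<close>
  define g where "g = (\<lambda>x. - 1 / (real k + 1 + x))"
  define g' where "g' = (\<lambda>x. 1 / (real k + 1 + x)\<^sup>2)"
  have [measurable]: "f \<in> borel_measurable borel" unfolding f_def by measurable
  have fg: "f (g x) * g' x = v (1 / (real k + 1 + x)) / ((real k + 1 + x) * (real k + 2 + x))"
    if "x \<ge> 0" for x
  proof -
    have ne: "real k + 1 + x \<noteq> 0" "real k + 2 + x \<noteq> 0" using that by auto
    have "1 + 1 / (real k + 1 + x) = (real k + 2 + x) / (real k + 1 + x)"
      using ne by (simp add: field_simps)
    then show ?thesis
      unfolding f_def g_def g'_def power2_eq_square using ne by simp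
  qed
  have "(\<integral>\<^sup>+x. ennreal (v (1 / (real k + 1 + x)) / ((real k + 1 + x) * (real k + 2 + x))) * indicator {0<..1} x \<partial>lborel)
      = (\<integral>\<^sup>+x. ennreal (f (g x) * g' x * indicator {0..1} x) \<partial>lborel)"
    using AE_lborel_singleton[of 0]
    by (intro nn_integral_cong_AE) (auto simp: fg split: split_indicator elim!: eventually_mono)
  also have "\<dots> = (\<integral>\<^sup>+x. ennreal (f x * indicator {g 0..g 1} x) \<partial>lborel)"
  proof (rule nn_integral_substitution[symmetric])
    show "set_borel_measurable borel {g 0..g 1} f"
      unfolding set_borel_measurable_def by measurable
    show "(g has_real_derivative g' x) (at x)" if "x \<in> {0..1}" for x
      unfolding g_def g'_def using that
      by (auto intro!: derivative_eq_intros simp: power2_eq_square)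
    show "continuous_on {0..1} g'"
      unfolding g'_def by (intro continuous_intros) auto
  qed (auto simp: g'_def)
  also have "\<dots> = (\<integral>\<^sup>+x. ennreal (f (- x) * indicator {g 0..g 1} (- x)) \<partial>lborel)"
    by (subst nn_integral_real_affine[where c = "-1" and t = 0]) auto
  also have "\<dots> = (\<integral>\<^sup>+x. ennreal (v x / (1 + x)) * indicator {1 / (real k + 2)<..1 / (real k + 1)} x \<partial>lborel)"
    using AE_lborel_singleton[of "1 / (real k + 2)"]
    by (intro nn_integral_cong_AE) (auto simp: f_def g_def add.commute split: split_indicator elim!: eventually_mono)
  finally show ?thesis .
qed

lemma gauss_cells:
  "disjoint_family (\<lambda>k. {1 / (real k + 2)<..1 / (real k + 1)})"
  "(\<Union>k. {1 / (real k + 2)<..1 / (real k + 1)}) = {0<..1}"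
proof -
  have mem: "x \<in> {1 / (real k + 2)<..1 / (real k + 1)} \<longleftrightarrow> x > 0 \<and> \<lfloor>1 / x\<rfloor> = int k + 1" for x k
  proof (cases "x > 0")
    case True
    then show ?thesis by (auto simp: floor_eq_iff field_simps)
  next
    case False
    have pos: "0 < 1 / (real k + 2)" by simp
    show ?thesis using False order.strict_trans[OF pos, of x] by auto
  qed
  show "disjoint_family (\<lambda>k. {1 / (real k + 2)<..1 / (real k + 1)})"
    unfolding disjoint_family_on_def set_eq_iff Int_iff mem by auto
  have "(\<exists>k. \<lfloor>1 / x\<rfloor> = int k + 1) \<longleftrightarrow> x \<le> 1" if "x > 0" for x :: real
  proof -
    have "(\<exists>k. \<lfloor>1 / x\<rfloor> = int k + 1) \<longleftrightarrow> \<lfloor>1 / x\<rfloor> \<ge> 1"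
      by (metis add.commute le_add_same_cancel1 of_nat_0_le_iff zle_iff_zadd)
    also have "\<dots> \<longleftrightarrow> x \<le> 1" using that by (simp add: le_floor_iff)
    finally show ?thesis .
  qed
  then show "(\<Union>k. {1 / (real k + 2)<..1 / (real k + 1)}) = {0<..1}"
    unfolding set_eq_iff UN_iff mem by auto
qed

text \<open>
  The \<open>k\<close>-th summand of the operator integrates to the integral of \<open>v\<close> over the \<open>k\<close>-th cell, and the
  cells partition the unit interval.
\<close>
lemma gauss_integral_gk_op:
  assumes v[measurable]: "v \<in> borel_measurable borel"
    and nonneg: "\<And>y. y \<in> {0<..1} \<Longrightarrow> v y \<ge> 0"
    and summable: "\<And>x. x \<in> {0..1} \<Longrightarrow> summable (\<lambda>k. gk_weight k x * v (1 / (real k + 1 + x)))"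
  shows "gauss_integral (gk_op v) = gauss_integral v"
proof -
  define F where "F = (\<lambda>k x. v (1 / (real k + 1 + x)) / ((real k + 1 + x) * (real k + 2 + x)))"
  have [measurable]: "F k \<in> borel_measurable borel" for k unfolding F_def by measurable
  have Fw: "F k x = gk_weight k x * v (1 / (real k + 1 + x)) / (1 + x)" if "x \<in> {0<..1}" for k x
    using that by (simp add: F_def gk_weight_def)
  have "ennreal (gk_op v x / (1 + x)) * indicator {0<..1} x = (\<Sum>k. ennreal (F k x) * indicator {0<..1} x)" for x
  proof (cases "x \<in> {0<..1}")
    case True
    have "(\<lambda>k. F k x) sums (gk_op v x / (1 + x))"
      unfolding Fw[OF True] gk_op_def using summable[of x] True by (intro sums_divide summable_sums) auto
    moreover have "F k x \<ge> 0" for k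
      unfolding Fw[OF True] using True gk_weight_nonneg[of x k] nonneg[of "1 / (real k + 1 + x)"]
      by (auto simp: field_simps)
    ultimately have "(\<Sum>k. ennreal (F k x)) = ennreal (gk_op v x / (1 + x))"
      by (subst suminf_ennreal2) (auto simp: sums_iff)
    then show ?thesis using True by simp
  qed simp
  then have "gauss_integral (gk_op v) = (\<integral>\<^sup>+x. (\<Sum>k. ennreal (F k x) * indicator {0<..1} x) \<partial>lborel)"
    by (simp add: gauss_integral_def)
  also have "\<dots> = (\<Sum>k. \<integral>\<^sup>+x. ennreal (F k x) * indicator {0<..1} x \<partial>lborel)"
    by (intro nn_integral_suminf) measurable
  also have "\<dots> = (\<Sum>k. \<integral>\<^sup>+x. ennreal (v x / (1 + x)) * indicator {1 / (real k + 2)<..1 / (real k + 1)} x \<partial>lborel)"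
    unfolding F_def gauss_integral_branch[OF v] ..
  also have "\<dots> = (\<integral>\<^sup>+x. (\<Sum>k. ennreal (v x / (1 + x)) * indicator {1 / (real k + 2)<..1 / (real k + 1)} x) \<partial>lborel)"
    by (intro nn_integral_suminf[symmetric]) measurable
  also have "\<dots> = gauss_integral v"
    unfolding gauss_integral_def ennreal_suminf_cmult suminf_indicator[OF gauss_cells(1)] gauss_cells(2) ..
  finally show ?thesis .
qed

lemma gauss_integral_const:
  assumes "c \<ge> 0"
  shows "gauss_integral (\<lambda>_. c) = ennreal (c * ln 2)"
proof -
  have "gauss_integral (\<lambda>_. c) = (\<integral>\<^sup>+x. ennreal (c / (1 + x)) * indicator {0..1} x \<partial>lborel)"
    unfolding gauss_integral_def using AE_lborel_singleton[of 0]
    by (intro nn_integral_cong_AE) (auto split: split_indicator elim!: eventually_mono)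
  also have "\<dots> = ennreal (c * ln (1 + 1) - c * ln (1 + 0))"
    using assms by (intro nn_integral_FTC_Icc) (auto intro!: derivative_eq_intros)
  finally show ?thesis by simp
qed

lemma nn_integral_power_ln:
  "(\<integral>\<^sup>+x. ennreal (- (x ^ n * ln x)) * indicator {0<..<1} x \<partial>lborel) = ennreal (1 / (real n + 1)\<^sup>2)"
proof -
  define F where "F = (\<lambda>x::real. x ^ (n + 1) / (real n + 1)\<^sup>2 - x ^ (n + 1) * ln x / (real n + 1))"
  define f where "f = (\<lambda>x::real. - (x ^ n * ln x))"
  have e: "einterval 0 1 = {0<..<1::real}"
    by (auto simp: einterval_def)
  have nn: "f x \<ge> 0" if "x \<in> {0<..<1}" for x
    using that by (auto simp: f_def mult_nonneg_nonpos)
  have F': "DERIV F x :> f x" if "0 < x" for x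
  proof -
    have p: "DERIV (\<lambda>x. x ^ (n + 1)) x :> real (n + 1) * x ^ n"
      using DERIV_pow[of "n + 1" x] by simp
    have "DERIV F x :> real (n + 1) * x ^ n / (real n + 1)\<^sup>2
        - (real (n + 1) * x ^ n * ln x + 1 / x * x ^ (n + 1)) / (real n + 1)"
      unfolding F_def using that by (intro DERIV_diff DERIV_cdivide DERIV_mult p DERIV_ln_divide)
    also have "1 / x * x ^ (n + 1) = x ^ n" using that by simp
    also have "real (n + 1) * x ^ n / (real n + 1)\<^sup>2
        - (real (n + 1) * x ^ n * ln x + x ^ n) / (real n + 1) = f x"
      by (simp add: f_def power2_eq_square divide_simps) (simp add: algebra_simps)
    finally show ?thesis .
  qed
  have lim0: "(F \<longlongrightarrow> 0) (at_right 0)"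
    unfolding F_def by real_asymp
  have lim1: "(F \<longlongrightarrow> 1 / (real n + 1)\<^sup>2) (at_left 1)"
  proof -
    have "isCont F 1" using F'[of 1] DERIV_isCont by auto
    then have "(F \<longlongrightarrow> F 1) (at_left 1)"
      by (simp add: isCont_def filterlim_at_split)
    then show ?thesis by (simp add: F_def)
  qed
  note FTC = interval_integral_FTC_nonneg[of 0 1 F f 0 "1 / (real n + 1)\<^sup>2"]
  have hyps: "DERIV F x :> f x" "isCont f x" if "0 < ereal x" "ereal x < 1" for x
    using that F' by (auto simp: f_def intro!: continuous_intros)
  have "AE x in lborel. 0 < ereal x \<longrightarrow> ereal x < 1 \<longrightarrow> 0 \<le> f x"
    using nn by (intro AE_I2) auto
  moreover have "((F \<circ> real_of_ereal) \<longlongrightarrow> 0) (at_right 0)"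
    using lim0 unfolding zero_ereal_def ereal_tendsto_simps1 .
  moreover have "((F \<circ> real_of_ereal) \<longlongrightarrow> 1 / (real n + 1)\<^sup>2) (at_left 1)"
    using lim1 unfolding one_ereal_def ereal_tendsto_simps1 .
  ultimately have int: "set_integrable lborel (einterval 0 1) f"
    and val: "(LBINT x=0..1. f x) = 1 / (real n + 1)\<^sup>2"
    using FTC[OF _ hyps] by auto
  have "(\<integral>\<^sup>+x. ennreal (f x) * indicator {0<..<1} x \<partial>lborel) = (\<integral>\<^sup>+x. ennreal (indicator {0<..<1} x *\<^sub>R f x) \<partial>lborel)"
    by (intro nn_integral_cong) (auto split: split_indicator)
  also have "\<dots> = ennreal (\<integral>x. indicator {0<..<1} x *\<^sub>R f x \<partial>lborel)"
    using int nn unfolding e set_integrable_def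
    by (intro nn_integral_eq_integral AE_I2) (auto split: split_indicator)
  also have "(\<integral>x. indicator {0<..<1} x *\<^sub>R f x \<partial>lborel) = 1 / (real n + 1)\<^sup>2"
    using val unfolding interval_lebesgue_integral_def e set_lebesgue_integral_def by simp
  finally show ?thesis by (simp add: f_def)
qed

text \<open>
  The sum over all inverse squares minus twice the sum over the even ones.
\<close>
lemma alternating_inverse_squares_sums:
  "(\<lambda>k. 1 / (2 * real k + 1)\<^sup>2 - 1 / (2 * real k + 2)\<^sup>2) sums (pi\<^sup>2 / 12)"
proof -
  define S where "S = (\<lambda>n. \<Sum>k<n. 1 / (real k + 1)\<^sup>2)"
  have S: "S \<longlonglongrightarrow> pi\<^sup>2 / 6"
    using inverse_squares_sums unfolding S_def sums_def by (simp add: add.commute)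
  have "(\<Sum>k<n. 1 / (2 * real k + 1)\<^sup>2 - 1 / (2 * real k + 2)\<^sup>2) = S (2 * n) - S n / 2" for n
  proof (induction n)
    case (Suc n)
    have "1 / (2 * real n + 2)\<^sup>2 = (1 / (real n + 1)\<^sup>2) / 4"
      by (simp add: power2_eq_square field_simps)
    moreover have "S (2 * Suc n) = S (2 * n) + 1 / (2 * real n + 1)\<^sup>2 + 1 / (2 * real n + 2)\<^sup>2"
      by (simp add: S_def)
    moreover have "S (Suc n) = S n + 1 / (real n + 1)\<^sup>2"
      by (simp add: S_def)
    moreover have "s - t / 2 + (a - b) = s + a + b - (t + c) / 2" if "b = c / 4" for s t a b c :: real
      using that by (simp add: field_simps)
    ultimately show ?case unfolding sum.lessThan_Suc Suc by metis
  qed (simp add: S_def)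
  moreover have "(\<lambda>n. S (2 * n) - S n / 2) \<longlonglongrightarrow> pi\<^sup>2 / 6 - pi\<^sup>2 / 6 / 2"
    by (intro tendsto_intros S filterlim_compose[OF S] mult_nat_left_at_top) auto
  ultimately show ?thesis by (simp add: sums_def)
qed

text \<open>
  Expanding \<open>1 / (1 + x) = \<Sum>\<^sub>k (x\<^bsup>2k\<^esup> - x\<^bsup>2k+1\<^esup>)\<close> with the terms grouped in pairs keeps
  every summand nonnegative, and each power contributes one inverse square.
\<close>
lemma gauss_integral_log: "gauss_integral (\<lambda>y. - 2 * ln y) = ennreal (pi\<^sup>2 / 6)"
proof -
  define F where "F = (\<lambda>n x::real. ennreal (- (x ^ n * ln x)) * indicator {0<..<1} x)"
  have F_int: "(\<integral>\<^sup>+x. F n x \<partial>lborel) = ennreal (1 / (real n + 1)\<^sup>2)" for n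
    unfolding F_def by (rule nn_integral_power_ln)
  have [measurable]: "F n \<in> borel_measurable lborel" for n unfolding F_def by measurable
  have F_le: "F (2 * k + 1) x \<le> F (2 * k) x" for k x
    unfolding F_def
    by (auto simp: ennreal_leI mult_le_cancel_right mult_left_le_one_le split: split_indicator intro!: ennreal_leI mult_right_mono_neg)
  have "ennreal (- 2 * ln x / (1 + x)) * indicator {0<..<1} x = (\<Sum>k. 2 * (F (2 * k) x - F (2 * k + 1) x))" for x
  proof (cases "x \<in> {0<..<1}")
    case True
    then have x: "0 < x" "x < 1" by auto
    have x2: "x\<^sup>2 < 1" using x by (simp add: power_less_one_iff)
    have summand: "2 * (F (2 * k) x - F (2 * k + 1) x) = ennreal (- 2 * ln x * (1 - x) * (x\<^sup>2) ^ k)" for k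
    proof -
      have "F (2 * k) x - F (2 * k + 1) x = ennreal (- (x ^ (2*k) * ln x) - - (x ^ (2*k + 1) * ln x))"
        using x by (simp add: F_def) (subst ennreal_minus, auto simp: mult_nonneg_nonpos mult_nonneg_nonpos2)
      also have "2 * \<dots> = ennreal (2 * (- (x ^ (2*k) * ln x) - - (x ^ (2*k + 1) * ln x)))"
        by (subst ennreal_mult') auto
      finally show ?thesis by (simp add: power_mult[symmetric] algebra_simps)
    qed
    have "(\<lambda>k. - 2 * ln x * (1 - x) * (x\<^sup>2) ^ k) sums (- 2 * ln x * (1 - x) * (1 / (1 - x\<^sup>2)))"
      using x2 by (intro sums_mult geometric_sums) auto
    moreover have "- 2 * ln x * (1 - x) * (x\<^sup>2) ^ k \<ge> 0" for k
    proof -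
      have "- 2 * ln x \<ge> 0" using x by simp
      then show ?thesis using x by (intro mult_nonneg_nonneg[of "- 2 * ln x * (1 - x)"] mult_nonneg_nonneg[of "- 2 * ln x"]) auto
    qed
    ultimately have "(\<Sum>k. 2 * (F (2 * k) x - F (2 * k + 1) x)) = ennreal (- 2 * ln x * (1 - x) * (1 / (1 - x\<^sup>2)))"
      unfolding summand by (subst suminf_ennreal2) (auto simp: sums_iff)
    also have "1 - x\<^sup>2 = (1 - x) * (1 + x)" by (simp add: power2_eq_square algebra_simps)
    finally show ?thesis using True by simp
  qed (auto simp: F_def)
  moreover have "gauss_integral (\<lambda>y. - 2 * ln y) = (\<integral>\<^sup>+x. ennreal (- 2 * ln x / (1 + x)) * indicator {0<..<1} x \<partial>lborel)"
    unfolding gauss_integral_def using AE_lborel_singleton[of 1]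
    by (intro nn_integral_cong_AE) (auto split: split_indicator elim!: eventually_mono)
  ultimately have "gauss_integral (\<lambda>y. - 2 * ln y) = (\<integral>\<^sup>+x. (\<Sum>k. 2 * (F (2 * k) x - F (2 * k + 1) x)) \<partial>lborel)"
    by simp
  also have "\<dots> = (\<Sum>k. \<integral>\<^sup>+x. 2 * (F (2 * k) x - F (2 * k + 1) x) \<partial>lborel)"
    by (intro nn_integral_suminf) measurable
  also have "\<dots> = (\<Sum>k. 2 * ((\<integral>\<^sup>+x. F (2 * k) x \<partial>lborel) - (\<integral>\<^sup>+x. F (2 * k + 1) x \<partial>lborel)))"
    using F_le F_int by (intro suminf_cong) (subst nn_integral_cmult, measurable, subst nn_integral_diff, auto)
  also have "\<dots> = (\<Sum>k. ennreal (2 * (1 / (2 * real k + 1)\<^sup>2 - 1 / (2 * real k + 2)\<^sup>2)))"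
    unfolding F_int
    by (intro suminf_cong) (subst ennreal_minus, simp, subst ennreal_mult', auto simp: add.commute)
  also have "\<dots> = ennreal (pi\<^sup>2 / 6)"
  proof -
    have s: "(\<lambda>k. 2 * (1 / (2 * real k + 1)\<^sup>2 - 1 / (2 * real k + 2)\<^sup>2)) sums (pi\<^sup>2 / 6)"
      using sums_mult[OF alternating_inverse_squares_sums, of 2] by simp
    have nn: "0 \<le> 2 * (1 / (2 * real k + 1)\<^sup>2 - 1 / (2 * real k + 2)\<^sup>2)" for k
      by (auto intro!: frac_le power_mono)
    show ?thesis
      unfolding suminf_ennreal2[OF nn sums_summable[OF s]] sums_unique[OF s, symmetric] ..
  qed
  finally show ?thesis .
qed

section \<open>Convergence of the iterates and an approximate Poisson equation\<close>

text \<open>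
  The entropy of the Gauss map, which is also the mean of \<open>- 2 ln\<close> under the normalised Gauss
  measure; its inverse is the typical value of \<open>\<ell>(x) / (2 ln r)\<close>.
\<close>
definition gk_entropy :: real where
  "gk_entropy = pi\<^sup>2 / (6 * ln 2)"

text \<open>
  The iteration starts from the image of \<open>- 2 ln\<close> under the operator, the first Lipschitz function of
  the sequence.
\<close>
definition gk_log_iter :: "nat \<Rightarrow> real \<Rightarrow> real" where
  "gk_log_iter j = (gk_op ^^ j) (gk_op (\<lambda>y. - 2 * ln y))"

lemma gk_log_iter_Suc: "gk_log_iter (Suc j) = gk_op (gk_log_iter j)"
  by (simp add: gk_log_iter_def)

lemma lipschitz_on_unit_bounded:
  fixes v :: "real \<Rightarrow> real"
  assumes "M-lipschitz_on {0..1} v" "y \<in> {0..1}"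
  shows "\<bar>v y\<bar> \<le> \<bar>v 0\<bar> + M"
proof -
  have "\<bar>v y - v 0\<bar> \<le> M * \<bar>y\<bar>"
    using lipschitz_onD[OF assms(1), of y 0] assms(2) by (simp add: dist_real_def)
  also have "\<dots> \<le> M * 1"
    using lipschitz_on_nonneg[OF assms(1)] assms(2) by (intro mult_left_mono) auto
  finally show ?thesis by linarith
qed

lemma gk_log_iter_lipschitz:
  "((26/27) ^ j * (22 * (\<Sum>k. (real k + 1) powr (-3/2))))-lipschitz_on {0..1} (gk_log_iter j)"
proof (induction j)
  case 0
  then show ?case using gk_op_log_lipschitz by (simp add: gk_log_iter_def)
next
  case (Suc j)
  from gk_op_lipschitz[OF this] show ?case by (simp add: gk_log_iter_Suc mult.assoc)
qed

lemma gk_op_nonneg: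
  assumes "x \<in> {0..1}" "\<And>y. y \<in> {0<..1} \<Longrightarrow> v y \<ge> 0"
    "summable (\<lambda>k. gk_weight k x * v (1 / (real k + 1 + x)))"
  shows "gk_op v x \<ge> 0"
  unfolding gk_op_def
proof (rule suminf_nonneg[OF assms(3)])
  fix k
  show "gk_weight k x * v (1 / (real k + 1 + x)) \<ge> 0"
    using branch_mem[OF assms(1), of k] assms(1)
    by (intro mult_nonneg_nonneg gk_weight_nonneg assms(2)) auto
qed

lemma borel_measurable_gk_op [measurable]:
  assumes [measurable]: "v \<in> borel_measurable borel"
  shows "gk_op v \<in> borel_measurable borel"
  unfolding gk_op_def gk_weight_def by measurable

lemma gk_log_iter_integral:
  shows "gk_log_iter j \<in> borel_measurable borel"
    and "x \<in> {0..1} \<Longrightarrow> gk_log_iter j x \<ge> 0"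
    and "gauss_integral (gk_log_iter j) = ennreal (pi\<^sup>2 / 6)"
proof -
  have log: "(\<lambda>y::real. - 2 * ln y) \<in> borel_measurable borel" by measurable
  have lognn: "- 2 * ln y \<ge> 0" if "y \<in> {0<..1}" for y :: real using that by simp
  have "gk_log_iter j \<in> borel_measurable borel \<and> (\<forall>x\<in>{0..1}. gk_log_iter j x \<ge> 0)
    \<and> gauss_integral (gk_log_iter j) = ennreal (pi\<^sup>2 / 6)"
  proof (induction j)
    case 0
    show ?case
      using borel_measurable_gk_op[OF log] gk_op_nonneg[OF _ lognn gk_op_log_summable]
        gauss_integral_gk_op[OF log lognn gk_op_log_summable] gauss_integral_log
      by (simp add: gk_log_iter_def)
  next
    case (Suc j)
    have summ: "summable (\<lambda>k. gk_weight k x * gk_log_iter j (1 / (real k + 1 + x)))" if "x \<in> {0..1}" for x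
      by (rule gk_op_summable[OF that lipschitz_on_unit_bounded[OF gk_log_iter_lipschitz]])
    have nn: "gk_log_iter j y \<ge> 0" if "y \<in> {0<..1}" for y using Suc that by auto
    from Suc have m: "gk_log_iter j \<in> borel_measurable borel" by simp
    show ?case
      using borel_measurable_gk_op[OF m] gk_op_nonneg[OF _ nn summ] gauss_integral_gk_op[OF m nn summ] Suc
      by (simp add: gk_log_iter_Suc)
  qed
  then show "gk_log_iter j \<in> borel_measurable borel"
    and "x \<in> {0..1} \<Longrightarrow> gk_log_iter j x \<ge> 0"
    and "gauss_integral (gk_log_iter j) = ennreal (pi\<^sup>2 / 6)" by auto
qed

lemma gauss_integral_mono:
  assumes "\<And>x. x \<in> {0<..1} \<Longrightarrow> v x \<le> w x"
  shows "gauss_integral v \<le> gauss_integral w"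
  unfolding gauss_integral_def
  by (intro nn_integral_mono) (auto intro!: ennreal_leI divide_right_mono assms split: split_indicator)

text \<open>
  The oscillation of the iterate is at most its Lipschitz constant, and its mean is
  \<^const>\<open>gk_entropy\<close> by invariance of the measure.
\<close>
lemma gk_log_iter_approx:
  assumes x: "x \<in> {0..1}"
  shows "\<bar>gk_log_iter j x - gk_entropy\<bar> \<le> (26/27) ^ j * (22 * (\<Sum>k. (real k + 1) powr (-3/2)))"
proof -
  define L where "L = (26/27) ^ j * (22 * (\<Sum>k. (real k + 1) powr (-3/2)))"
  have L: "L-lipschitz_on {0..1} (gk_log_iter j)" "L \<ge> 0"
    using gk_log_iter_lipschitz[of j] lipschitz_on_nonneg[OF gk_log_iter_lipschitz[of j]]
    unfolding L_def by blast+
  have ln2: "ln 2 > (0::real)" by simp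
  have int: "gauss_integral (gk_log_iter j) = ennreal (gk_entropy * ln 2)"
    using gk_log_iter_integral(3) by (simp add: gk_entropy_def)
  have ent: "gk_entropy \<ge> 0" by (simp add: gk_entropy_def)
  have osc: "gk_log_iter j x - L \<le> gk_log_iter j y" "gk_log_iter j y \<le> gk_log_iter j x + L" if y: "y \<in> {0<..1}" for y
  proof -
    have "\<bar>gk_log_iter j x - gk_log_iter j y\<bar> \<le> L * \<bar>x - y\<bar>"
      using lipschitz_onD[OF L(1) x, of y] y by (simp add: dist_real_def)
    also have "\<dots> \<le> L * 1" using x y L(2) by (intro mult_left_mono) auto
    finally show "gk_log_iter j x - L \<le> gk_log_iter j y" "gk_log_iter j y \<le> gk_log_iter j x + L"
      by (simp_all add: abs_le_iff)
  qed
  have "gk_log_iter j x - L \<le> gk_entropy"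
  proof (cases "gk_log_iter j x - L \<ge> 0")
    case True
    have "gauss_integral (\<lambda>_. gk_log_iter j x - L) \<le> gauss_integral (gk_log_iter j)"
      by (intro gauss_integral_mono osc)
    then show ?thesis
      using ln2 ent unfolding gauss_integral_const[OF True] int by (subst (asm) ennreal_le_iff) auto
  qed (use ent in auto)
  moreover have "gk_entropy \<le> gk_log_iter j x + L"
  proof -
    have nn: "gk_log_iter j x + L \<ge> 0" using gk_log_iter_integral(2)[OF x] L by simp
    have "gauss_integral (gk_log_iter j) \<le> gauss_integral (\<lambda>_. gk_log_iter j x + L)"
      by (intro gauss_integral_mono osc)
    then show ?thesis
      using ln2 nn unfolding gauss_integral_const[OF nn] int by (subst (asm) ennreal_le_iff) auto
  qed
  ultimately show ?thesis unfolding L_def by (simp add: abs_le_iff)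
qed

text \<open>
  With \<open>u = \<Sum>\<^sub>j\<^sub><\<^sub>m (h - w\<^sub>j)\<close> and \<open>w\<^sub>j\<^sub>+\<^sub>1 = gk_op w\<^sub>j\<close>, the difference \<open>u - gk_op u\<close> telescopes to
  \<open>w\<^sub>m - w\<^sub>0\<close>, and \<open>w\<^sub>m\<close> is uniformly close to \<open>h\<close>.
\<close>
lemma approximate_poisson_equation:
  assumes "\<eta> > 0"
  obtains u B where "\<And>x. x \<in> {0..1} \<Longrightarrow> \<bar>u x\<bar> \<le> B"
    and "\<And>x. x \<in> {0..1} \<Longrightarrow> \<bar>u x - gk_op u x + gk_op (\<lambda>y. - 2 * ln y) x - gk_entropy\<bar> \<le> \<eta>"
proof -
  define K where "K = 22 * (\<Sum>k. (real k + 1) powr (-3/2))"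
  have "(\<lambda>m. (26/27) ^ m * K) \<longlonglongrightarrow> 0 * K"
    by (intro tendsto_intros LIMSEQ_power_zero) auto
  then have "eventually (\<lambda>m. (26/27) ^ m * K < \<eta>) sequentially"
    using assms by (simp add: order_tendstoD(2))
  then obtain m where m: "(26/27) ^ m * K < \<eta>"
    by (auto simp: eventually_sequentially)
  define u where "u = (\<lambda>n x. \<Sum>j<n. gk_entropy - gk_log_iter j x)"
  have step: "(\<forall>x\<in>{0..1}. \<bar>u n x\<bar> \<le> real n * K) \<and>
      (\<forall>x\<in>{0..1}. u n x - gk_op (u n) x = gk_log_iter n x - gk_log_iter 0 x)" for n
  proof (induction n)
    case 0
    then show ?case by (auto simp: u_def gk_op_const[of _ 0])
  next
    case (Suc n)
    have K: "K \<ge> 0" unfolding K_def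
      by (intro mult_nonneg_nonneg suminf_nonneg summable_powr_three_halves) simp_all
    have d: "\<bar>gk_entropy - gk_log_iter n x\<bar> \<le> K" if "x \<in> {0..1}" for x
    proof -
      have "(26/27) ^ n * K \<le> 1 * K" using K by (intro mult_right_mono power_le_one) auto
      then show ?thesis using gk_log_iter_approx[OF that, of n] unfolding K_def by linarith
    qed
    have uS: "u (Suc n) = (\<lambda>x. 1 * u n x + 1 * (gk_entropy - gk_log_iter n x))"
      by (simp add: u_def)
    have "gk_op (u (Suc n)) x = gk_op (u n) x + (gk_entropy - gk_log_iter (Suc n) x)" if x: "x \<in> {0..1}" for x
    proof -
      have "gk_op (\<lambda>x. gk_entropy - gk_log_iter n x) x = gk_op (\<lambda>x. 1 * gk_entropy + (-1) * gk_log_iter n x) x"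
        by simp
      also have "\<dots> = 1 * gk_op (\<lambda>_. gk_entropy) x + (-1) * gk_op (gk_log_iter n) x"
        by (rule gk_op_lincomb[OF x _ lipschitz_on_unit_bounded[OF gk_log_iter_lipschitz]]) auto
      also have "\<dots> = gk_entropy - gk_log_iter (Suc n) x"
        using x by (simp add: gk_op_const gk_log_iter_Suc)
      finally have 1: "gk_op (\<lambda>x. gk_entropy - gk_log_iter n x) x = gk_entropy - gk_log_iter (Suc n) x" .
      have "gk_op (u (Suc n)) x = 1 * gk_op (u n) x + 1 * gk_op (\<lambda>x. gk_entropy - gk_log_iter n x) x"
        unfolding uS by (rule gk_op_lincomb[OF x]) (use Suc d in auto)
      then show ?thesis using 1 by simp
    qed
    moreover have "\<bar>u (Suc n) x\<bar> \<le> real (Suc n) * K" if "x \<in> {0..1}" for x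
    proof -
      have "\<bar>u n x\<bar> \<le> real n * K" using Suc that by blast
      moreover have "real (Suc n) * K = real n * K + K" by (simp add: algebra_simps)
      ultimately show ?thesis
        using d[OF that] abs_triangle_ineq[of "u n x" "gk_entropy - gk_log_iter n x"]
        unfolding uS mult_1 by linarith
    qed
    ultimately show ?case using Suc by (auto simp: uS)
  qed
  show thesis
  proof (rule that[of "u m" "real m * K"])
    show "\<bar>u m x\<bar> \<le> real m * K" if "x \<in> {0..1}" for x using step that by blast
    show "\<bar>u m x - gk_op (u m) x + gk_op (\<lambda>y. - 2 * ln y) x - gk_entropy\<bar> \<le> \<eta>" if "x \<in> {0..1}" for x
    proof -
      have "u m x - gk_op (u m) x = gk_log_iter m x - gk_op (\<lambda>y. - 2 * ln y) x"
        using step that by (simp add: gk_log_iter_def)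
      then show ?thesis
        using gk_log_iter_approx[OF that, of m] m unfolding K_def by linarith
    qed
  qed
qed

section \<open>Perturbed eigenfunctions of the weighted transfer operator\<close>

lemma exp_le_quadratic: "exp z \<le> 1 + z + z\<^sup>2 * exp \<bar>z\<bar>" for z :: real
proof -
  have 1: "exp z - 1 \<le> z * exp z"
    using exp_ge_add_one_self[of "- z"] mult_left_mono[of "1 - z" "exp (- z)" "exp z"]
    by (simp add: exp_minus algebra_simps)
  show ?thesis
  proof (cases "z \<ge> 0")
    case True
    have "exp z - 1 - z \<le> z * (exp z - 1)" using 1 by (simp add: algebra_simps)
    also have "\<dots> \<le> z * (z * exp z)" using 1 True by (intro mult_left_mono)
    finally show ?thesis using True by (simp add: power2_eq_square algebra_simps)
  next
    case False
    have "exp z - 1 - z \<le> (- z) * (1 - exp z)" using 1 by (simp add: algebra_simps)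
    also have "1 - exp z \<le> - z" using exp_ge_add_one_self[of z] by linarith
    then have "(- z) * (1 - exp z) \<le> (- z) * (- z)" using False by (intro mult_left_mono) auto
    also have "\<dots> = z\<^sup>2 * 1" by (simp add: power2_eq_square)
    also have "\<dots> \<le> z\<^sup>2 * exp \<bar>z\<bar>" by (intro mult_left_mono) auto
    finally show ?thesis by simp
  qed
qed

text \<open>
  The exponent \<open>1/2\<close> in the error term is chosen so that the error remains summable against
  \<^const>\<open>gk_weight\<close>.
\<close>
lemma powr_near_one_expansion:
  assumes y: "y \<ge> (1::real)" and t: "\<bar>t\<bar> \<le> 1/16"
  shows "y powr (- 2 * t) \<le> 1 - 2 * t * ln y + 256 * t\<^sup>2 * y powr (1/2)"
proof -
  have ln: "0 \<le> ln y" "ln y \<le> 8 * y powr (1/8)"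
  proof -
    have "ln y = 8 * ln (y powr (1/8))" using y by (simp add: ln_powr)
    also have "\<dots> \<le> 8 * (y powr (1/8))"
      using y ln_le_minus_one[of "y powr (1/8)"] by (intro mult_left_mono) auto
    finally show "ln y \<le> 8 * y powr (1/8)" .
  qed (use y in simp)
  have "(2 * t * ln y)\<^sup>2 * exp \<bar>2 * t * ln y\<bar> \<le> (4 * t\<^sup>2 * (64 * y powr (1/4))) * y powr (1/8)"
  proof (intro mult_mono)
    have "(ln y)\<^sup>2 \<le> (8 * y powr (1/8))\<^sup>2" using ln by (intro power_mono) auto
    also have "\<dots> = 64 * y powr (1/4)"
      using y by (simp add: power_mult_distrib power2_eq_square powr_add[symmetric])
    finally have "(ln y)\<^sup>2 \<le> 64 * y powr (1/4)" .
    from mult_left_mono[OF this, of "4 * t\<^sup>2"]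
    show "(2 * t * ln y)\<^sup>2 \<le> 4 * t\<^sup>2 * (64 * y powr (1/4))"
      by (simp add: power_mult_distrib)
    have "\<bar>2 * t * ln y\<bar> = (2 * \<bar>t\<bar>) * ln y" using ln by (simp add: abs_mult)
    also have "\<dots> \<le> (1/8) * ln y" using t ln by (intro mult_right_mono) auto
    finally show "exp \<bar>2 * t * ln y\<bar> \<le> y powr (1/8)" using y by (simp add: powr_def)
  qed auto
  also have "\<dots> = 256 * t\<^sup>2 * (y powr (1/4) * y powr (1/8))" by simp
  also have "\<dots> \<le> 256 * t\<^sup>2 * y powr (1/2)"
    unfolding powr_add[symmetric] using y by (intro mult_left_mono powr_mono) auto
  finally have "(- 2 * t * ln y)\<^sup>2 * exp \<bar>- 2 * t * ln y\<bar> \<le> 256 * t\<^sup>2 * y powr (1/2)" by simp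
  with exp_le_quadratic[of "- 2 * t * ln y"] show ?thesis
    using y by (simp add: powr_def)
qed

lemma gk_weight_sqrt_le:
  assumes x: "x \<in> {0..1}"
  shows "gk_weight k x * (real k + 1 + x) powr (1/2) \<le> 4 * (real k + 1) powr (-3/2)"
proof -
  have "(real k + 1 + x) powr (1/2) \<le> (4 * (real k + 1)) powr (1/2)"
    using x by (intro powr_mono2) auto
  also have "\<dots> = 2 * (real k + 1) powr (1/2)"
    by (subst powr_mult) (auto simp: powr_half_sqrt)
  finally have "gk_weight k x * (real k + 1 + x) powr (1/2) \<le> 2 / (real k + 1)\<^sup>2 * (2 * (real k + 1) powr (1/2))"
    using x gk_weight_le[OF x, of k] gk_weight_nonneg[of x k] by (intro mult_mono) auto
  also have "\<dots> = 4 * ((real k + 1) powr (1/2) / (real k + 1)\<^sup>2)" by simp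
  finally show ?thesis unfolding divide_square_eq_powr .
qed

text \<open>
  For \<open>f = (1 + t u) / (1 + x)\<close> and after multiplication by \<open>1 + x\<close>, the left side is at most
  \<open>1 + t (gk_op u - gk_op (- 2 ln)) + O(t\<^sup>2)\<close>, which the Poisson equation turns into
  \<open>1 + t u - t h + O(\<eta> \<bar>t\<bar> + t\<^sup>2)\<close>, the first-order expansion of \<open>exp (- t h) (1 + t u)\<close>.
  Finite sums are bounded because the sets of rationals to which this is applied are finite.
\<close>
lemma perturbed_eigenfunction:
  assumes "\<eta> > 0"
  obtains t\<^sub>0 where "t\<^sub>0 > 0" and
    "\<And>t. \<bar>t\<bar> \<le> t\<^sub>0 \<Longrightarrow> \<exists>f. (\<forall>x\<in>{0..1}. 1/4 \<le> f x \<and> f x \<le> 3/2) \<and>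
       (\<forall>x\<in>{0..1}. \<forall>K. finite K \<longrightarrow>
          (\<Sum>k\<in>K. (real k + 1 + x) powr (- 2 - 2 * t) * f (1 / (real k + 1 + x)))
            \<le> exp (- t * gk_entropy + \<eta> * \<bar>t\<bar>) * f x)"
proof -
  \<comment> \<open>Only half of \<open>3 \<eta>' \<bar>t\<bar>\<close> survives the factor \<open>1 + t u \<ge> 1/2\<close>; it pays for the error of the Poisson equation and for \<open>Q t\<^sup>2\<close>.\<close>
  define \<eta>' where "\<eta>' = \<eta> / 3"
  have \<eta>': "\<eta>' > 0" using assms by (simp add: \<eta>'_def)
  obtain u B0 where B0: "\<And>x. x \<in> {0..1} \<Longrightarrow> \<bar>u x\<bar> \<le> B0"
    and poisson: "\<And>x. x \<in> {0..1} \<Longrightarrow> \<bar>u x - gk_op u x + gk_op (\<lambda>y. - 2 * ln y) x - gk_entropy\<bar> \<le> \<eta>'"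
    using approximate_poisson_equation[OF \<eta>'] by metis
  define B where "B = max B0 1"
  have B: "B \<ge> 1" "\<And>x. x \<in> {0..1} \<Longrightarrow> \<bar>u x\<bar> \<le> B" using B0 by (auto simp: B_def le_max_iff_disj)
  define Z where "Z = (\<Sum>k. (real k + 1) powr (-3/2))"
  have Z: "Z \<ge> 0" unfolding Z_def by (intro suminf_nonneg summable_powr_three_halves) simp
  \<comment> \<open>\<open>C\<close> bounds the second-order terms of one summand, \<open>Q\<close> those of the whole inequality.\<close>
  define C where "C = 4 * B + 512"
  define Q where "Q = C * (4 * Z) + gk_entropy * B"
  have ent: "gk_entropy \<ge> 0" by (simp add: gk_entropy_def)
  have C: "C \<ge> 0" using B by (simp add: C_def)
  have Q: "Q \<ge> 0" unfolding Q_def using C Z ent B by auto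
  \<comment> \<open>In order: the range of the expansion of the power, \<open>\<bar>t u\<bar> \<le> 1/2\<close>, and absorption of \<open>Q t\<^sup>2\<close> into \<open>\<eta>' \<bar>t\<bar>\<close>.\<close>
  define t\<^sub>0 where "t\<^sub>0 = min (1/16) (min (1 / (2 * B)) (\<eta>' / (2 * (Q + 1))))"
  have t0: "t\<^sub>0 > 0" using \<eta>' B Q ent by (auto simp: t\<^sub>0_def)
  show thesis
  proof (rule that[OF t0])
    fix t :: real assume t: "\<bar>t\<bar> \<le> t\<^sub>0"
    then have t1: "\<bar>t\<bar> \<le> 1/16" and t2: "\<bar>t\<bar> * B \<le> 1/2" and t3: "\<bar>t\<bar> * Q \<le> \<eta>' / 2"
    proof -
      show "\<bar>t\<bar> \<le> 1/16" using t by (simp add: t\<^sub>0_def)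
      have "\<bar>t\<bar> \<le> 1 / (2 * B)" using t by (simp add: t\<^sub>0_def)
      then show "\<bar>t\<bar> * B \<le> 1/2" using B by (simp add: field_simps)
      have "\<bar>t\<bar> \<le> \<eta>' / (2 * (Q + 1))" using t by (simp add: t\<^sub>0_def)
      then have "\<bar>t\<bar> * (Q + 1) \<le> \<eta>' / 2" using Q by (simp add: field_simps)
      then show "\<bar>t\<bar> * Q \<le> \<eta>' / 2" by (simp add: algebra_simps)
    qed
    have tu: "\<bar>t * u x\<bar> \<le> 1/2" if "x \<in> {0..1}" for x
    proof -
      have "\<bar>t * u x\<bar> \<le> \<bar>t\<bar> * B" unfolding abs_mult using B(2)[OF that] by (intro mult_left_mono) auto
      then show ?thesis using t2 by linarith
    qed
    define f where "f = (\<lambda>x. (1 + t * u x) / (1 + x))"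
    have bounds: "1/4 \<le> f x \<and> f x \<le> 3/2" if x: "x \<in> {0..1}" for x
    proof -
      have "1/2 \<le> 1 + t * u x" "1 + t * u x \<le> 3/2" using tu[OF x] by (auto simp: abs_le_iff)
      moreover have "1 + x \<le> 2" "3/2 * 1 \<le> 3/2 * (1 + x)" using x by auto
      ultimately show ?thesis
        unfolding f_def using x by (simp add: le_divide_eq divide_le_eq)
    qed
    have main: "(\<Sum>k\<in>K. (real k + 1 + x) powr (- 2 - 2 * t) * f (1 / (real k + 1 + x)))
        \<le> exp (- t * gk_entropy + \<eta> * \<bar>t\<bar>) * f x"
      if x: "x \<in> {0..1}" and K: "finite K" for x K
    proof -
      define y where "y = (\<lambda>k. real k + 1 + x)"
      define d where "d = (\<lambda>k. gk_weight k x * (1 + t * u (1 / y k) - t * (- 2 * ln (1 / y k))) + C * t\<^sup>2 * (gk_weight k x * y k powr (1/2)))"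
      have y: "y k \<ge> 1" "1 / y k \<in> {0..1}" for k
        using x unfolding y_def by (auto simp: field_simps)
      have w: "gk_weight k x \<ge> 0" for k using x gk_weight_nonneg by simp
      have s\<^sub>u: "(\<lambda>k. gk_weight k x * u (1 / y k)) sums gk_op u x"
        unfolding y_def gk_op_def by (intro summable_sums gk_op_summable[OF x B0])
      have s\<^sub>l: "(\<lambda>k. gk_weight k x * (- 2 * ln (1 / y k))) sums gk_op (\<lambda>y. - 2 * ln y) x"
        unfolding y_def gk_op_def by (intro summable_sums gk_op_log_summable[OF x])
      have s\<^sub>1: "(\<lambda>k. gk_weight k x) sums 1" using gk_weight_sums x by simp
      have s\<^sub>q: "summable (\<lambda>k. gk_weight k x * y k powr (1/2))"
        and q: "(\<Sum>k. gk_weight k x * y k powr (1/2)) \<le> 4 * Z"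
      proof -
        have le: "gk_weight k x * y k powr (1/2) \<le> 4 * (real k + 1) powr (-3/2)" for k
          unfolding y_def using gk_weight_sqrt_le[OF x] .
        have s: "summable (\<lambda>k. 4 * (real k + 1) powr (-3/2))"
          by (intro summable_mult summable_powr_three_halves)
        show sq: "summable (\<lambda>k. gk_weight k x * y k powr (1/2))"
          by (rule summable_comparison_test'[OF s]) (use le w in auto)
        have "(\<Sum>k. gk_weight k x * y k powr (1/2)) \<le> (\<Sum>k. 4 * (real k + 1) powr (-3/2))"
          by (intro suminf_le le sq s)
        then show "(\<Sum>k. gk_weight k x * y k powr (1/2)) \<le> 4 * Z"
          unfolding Z_def using suminf_mult[OF summable_powr_three_halves, of 4] by linarith
      qed
      have d_sums: "d sums (1 + t * gk_op u x - t * gk_op (\<lambda>y. - 2 * ln y) x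
          + C * t\<^sup>2 * (\<Sum>k. gk_weight k x * y k powr (1/2)))"
      proof -
        have "(\<lambda>k. gk_weight k x + t * (gk_weight k x * u (1 / y k)) - t * (gk_weight k x * (- 2 * ln (1 / y k)))
            + C * t\<^sup>2 * (gk_weight k x * y k powr (1/2))) sums (1 + t * gk_op u x - t * gk_op (\<lambda>y. - 2 * ln y) x
          + C * t\<^sup>2 * (\<Sum>k. gk_weight k x * y k powr (1/2)))"
          by (intro sums_add sums_diff sums_mult s\<^sub>1 s\<^sub>u s\<^sub>l summable_sums[OF s\<^sub>q])
        moreover have "d = (\<lambda>k. gk_weight k x + t * (gk_weight k x * u (1 / y k)) - t * (gk_weight k x * (- 2 * ln (1 / y k)))
            + C * t\<^sup>2 * (gk_weight k x * y k powr (1/2)))"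
          unfolding d_def by (simp add: fun_eq_iff algebra_simps)
        ultimately show ?thesis by simp
      qed
      have le_d: "(1 + x) * (y k powr (- 2 - 2 * t) * f (1 / y k)) \<le> d k"
        and nonneg: "0 \<le> (1 + x) * (y k powr (- 2 - 2 * t) * f (1 / y k))" for k
      proof -
        have fpos: "f (1 / y k) \<ge> 0" using bounds[OF y(2)[of k]] by linarith
        then show "0 \<le> (1 + x) * (y k powr (- 2 - 2 * t) * f (1 / y k))" using x by simp
        define U where "U = u (1 / y k)"
        have U: "\<bar>t * U\<bar> \<le> 1/2" "\<bar>U\<bar> \<le> B" using tu[OF y(2)] B(2)[OF y(2)] by (auto simp: U_def)
        have "(1 + x) * (y k powr (- 2 - 2 * t) * f (1 / y k)) = gk_weight k x * (y k powr (- 2 * t) * (1 + t * U))"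
        proof -
          have "- 2 - 2 * t = - 2 * t - 2" by simp
          then have "y k powr (- 2 - 2 * t) = y k powr (- 2 * t) / y k powr 2"
            by (simp only: powr_diff)
          then have "y k powr (- 2 - 2 * t) = y k powr (- 2 * t) / (y k)\<^sup>2"
            using y(1)[of k] by (simp add: powr_realpow)
          moreover have "f (1 / y k) = (1 + t * U) * y k / (y k + 1)"
            using y(1)[of k] unfolding f_def U_def[symmetric] by (simp add: field_simps)
          moreover have "gk_weight k x = (1 + x) / (y k * (y k + 1))"
            by (simp add: gk_weight_def y_def add_ac)
          ultimately show ?thesis using y(1)[of k] by (simp add: power2_eq_square)
        qed
        also have "\<dots> \<le> gk_weight k x * ((1 + t * U - t * (2 * ln (y k))) + C * t\<^sup>2 * y k powr (1/2))"
        proof (intro mult_left_mono w)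
          have lnsq: "0 \<le> ln (y k)" "ln (y k) \<le> 2 * y k powr (1/2)"
            using y(1)[of k] ln_le_minus_one[of "y k powr (1/2)"] by (auto simp: ln_powr)
          have "y k powr (- 2 * t) * (1 + t * U) \<le> (1 - 2 * t * ln (y k) + 256 * t\<^sup>2 * y k powr (1/2)) * (1 + t * U)"
            using U by (intro mult_right_mono powr_near_one_expansion[OF y(1) t1]) (auto simp: abs_le_iff)
          also have "\<dots> = (1 + t * U - t * (2 * ln (y k))) + t\<^sup>2 * (2 * ln (y k) * (- U)) + 256 * t\<^sup>2 * y k powr (1/2) * (1 + t * U)"
            by (simp add: power2_eq_square algebra_simps)
          also have "\<dots> \<le> (1 + t * U - t * (2 * ln (y k))) + t\<^sup>2 * (2 * (2 * y k powr (1/2)) * B) + 256 * t\<^sup>2 * y k powr (1/2) * 2"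
          proof (intro add_mono mult_left_mono order_refl)
            have "2 * ln (y k) * (- U) \<le> 2 * ln (y k) * B"
              using U lnsq by (intro mult_left_mono) auto
            also have "\<dots> \<le> 2 * (2 * y k powr (1/2)) * B"
              using lnsq B by (intro mult_right_mono) auto
            finally show "2 * ln (y k) * (- U) \<le> 2 * (2 * y k powr (1/2)) * B" .
          qed (use U in \<open>auto simp: abs_le_iff\<close>)
          also have "\<dots> = (1 + t * U - t * (2 * ln (y k))) + C * t\<^sup>2 * y k powr (1/2)"
            by (simp add: C_def algebra_simps)
          finally show "y k powr (- 2 * t) * (1 + t * U) \<le> (1 + t * U - t * (2 * ln (y k))) + C * t\<^sup>2 * y k powr (1/2)" .
        qed
        also have "\<dots> = d k"
          unfolding d_def y_def gk_op_log_term[OF x] U_def by (simp add: algebra_simps)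
        finally show "(1 + x) * (y k powr (- 2 - 2 * t) * f (1 / y k)) \<le> d k" .
      qed
      have "(1 + x) * (\<Sum>k\<in>K. y k powr (- 2 - 2 * t) * f (1 / y k)) \<le> (\<Sum>k\<in>K. d k)"
        unfolding sum_distrib_left by (intro sum_mono le_d)
      also have "\<dots> \<le> (\<Sum>k. d k)"
        using order_trans[OF nonneg le_d] by (intro sum_le_suminf sums_summable[OF d_sums] K) auto
      also have "\<dots> = 1 + t * gk_op u x - t * gk_op (\<lambda>y. - 2 * ln y) x
          + C * t\<^sup>2 * (\<Sum>k. gk_weight k x * y k powr (1/2))"
        using d_sums by (simp add: sums_iff)
      also have "\<dots> \<le> 1 + t * gk_op u x - t * gk_op (\<lambda>y. - 2 * ln y) x + C * t\<^sup>2 * (4 * Z)"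
        using q C by (intro add_left_mono mult_left_mono) auto
      also have "\<dots> \<le> (1 - t * gk_entropy + 3 * \<eta>' * \<bar>t\<bar>) * (1 + t * u x)"
      proof -
        define e where "e = u x - gk_op u x + gk_op (\<lambda>y. - 2 * ln y) x - gk_entropy"
        have e: "\<bar>e\<bar> \<le> \<eta>'" using poisson[OF x] by (simp add: e_def)
        have te: "- (t * e) \<le> \<bar>t\<bar> * \<eta>'"
          using e abs_ge_minus_self[of "t * e"] mult_left_mono[OF e, of "\<bar>t\<bar>"] by (simp add: abs_mult)
        have 1: "1 + t * gk_op u x - t * gk_op (\<lambda>y. - 2 * ln y) x = 1 + t * u x - t * gk_entropy - t * e"
          by (simp add: e_def algebra_simps)
        have 2: "\<bar>t\<bar> * \<eta>' * (3/2) \<le> 3 * \<eta>' * \<bar>t\<bar> * (1 + t * u x)"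
        proof -
          have "3 * \<eta>' * \<bar>t\<bar> * (1/2) \<le> 3 * \<eta>' * \<bar>t\<bar> * (1 + t * u x)"
            using tu[OF x] \<eta>' by (intro mult_left_mono) (auto simp: abs_le_iff)
          then show ?thesis by (simp add: mult_ac)
        qed
        have 3: "t\<^sup>2 * (gk_entropy * u x) \<le> t\<^sup>2 * (gk_entropy * B)"
          using B(2)[OF x] ent by (intro mult_left_mono) auto
        have 4: "t\<^sup>2 * Q \<le> \<bar>t\<bar> * \<eta>' / 2"
          using mult_left_mono[OF t3, of "\<bar>t\<bar>"] by (simp add: power2_eq_square flip: mult.assoc)
        have 5: "t\<^sup>2 * Q = C * t\<^sup>2 * (4 * Z) + t\<^sup>2 * (gk_entropy * B)"
          by (simp add: Q_def algebra_simps)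
        have 6: "(1 - t * gk_entropy + 3 * \<eta>' * \<bar>t\<bar>) * (1 + t * u x)
            = 1 + t * u x - t * gk_entropy - t\<^sup>2 * (gk_entropy * u x) + 3 * \<eta>' * \<bar>t\<bar> * (1 + t * u x)"
          by (simp add: power2_eq_square algebra_simps)
        have "a - b + c \<le> a - p + w"
          if "- b \<le> m" "m * (3/2) \<le> w" "p \<le> r" "s \<le> m / 2" "s = c + r" for a b c m p r s w :: real
          using that by linarith
        from this[OF te 2 3 4 5] show ?thesis unfolding 1 6 .
      qed
      also have "\<dots> \<le> exp (- t * gk_entropy + \<eta> * \<bar>t\<bar>) * (1 + t * u x)"
      proof (intro mult_right_mono)
        have "3 * \<eta>' * \<bar>t\<bar> = \<eta> * \<bar>t\<bar>" by (simp add: \<eta>'_def)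
        then show "1 - t * gk_entropy + 3 * \<eta>' * \<bar>t\<bar> \<le> exp (- t * gk_entropy + \<eta> * \<bar>t\<bar>)"
          using exp_ge_add_one_self[of "- t * gk_entropy + \<eta> * \<bar>t\<bar>"] by linarith
        show "0 \<le> 1 + t * u x" using tu[OF x] by linarith
      qed
      also have "\<dots> = (1 + x) * (exp (- t * gk_entropy + \<eta> * \<bar>t\<bar>) * f x)"
        using x by (simp add: f_def)
      finally show ?thesis using x unfolding y_def by (subst (asm) mult_le_cancel_left_pos) auto
    qed
    show "\<exists>f. (\<forall>x\<in>{0..1}. 1/4 \<le> f x \<and> f x \<le> 3/2) \<and>
       (\<forall>x\<in>{0..1}. \<forall>K. finite K \<longrightarrow>
          (\<Sum>k\<in>K. (real k + 1 + x) powr (- 2 - 2 * t) * f (1 / (real k + 1 + x)))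
            \<le> exp (- t * gk_entropy + \<eta> * \<bar>t\<bar>) * f x)"
      using bounds main by blast
  qed
qed

section \<open>Rationals of given depth, and the size of the set of fractions\<close>

lemma denom_divide_coprime:
  assumes "coprime a b" "b > 0"
  shows "denom (of_int a / of_int b) = b"
  using assms by (simp add: denom_def Fract_of_int_quotient[symmetric] quotient_of_Fract normalize_stable)

text \<open>
  For \<open>x = p / r\<close> in lowest terms, the Gauss map gives \<open>(r mod p) / p\<close>, again in lowest terms.
\<close>
lemma denom_gauss_map:
  assumes "0 < x" "x < 1"
  shows "of_int (denom (gauss_map x)) = x * of_int (denom x)"
proof -
  obtain a b where ab: "quotient_of x = (a, b)" by (cases "quotient_of x")
  have b: "b > 0" and x: "x = of_int a / of_int b" and cop: "coprime a b"
    using ab quotient_of_denom_pos quotient_of_div quotient_of_coprime by auto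
  have a: "a > 0" using b x assms by (simp add: zero_less_divide_iff)
  have "x = of_nat (nat a) / of_nat (nat b)" using a b x by simp
  then have "gauss_map x = of_nat (nat b mod nat a) / of_nat (nat a)"
    using gauss_map_of_nat_divide[of "nat a" "nat b"] a by simp
  also have "\<dots> = of_int (b mod a) / of_int a"
    using a b by (simp flip: nat_mod_distrib)
  finally have "denom (gauss_map x) = a"
    using denom_divide_coprime[of "b mod a" a] a cop by (simp add: coprime_commute)
  moreover have "denom x = b" by (simp add: denom_def ab)
  ultimately show ?thesis using x b by simp
qed

lemma denom_pos: "denom x > 0"
  unfolding denom_def using quotient_of_denom_pos[of x] by (cases "quotient_of x") auto

text \<open>
  The rationals reached from \<open>0\<close> by prepending \<open>n\<close> digits. Requiring each point to be positive
  excludes \<open>0\<close> itself, a fixed point of \<^const>\<open>gauss_map\<close>, from every level but \<open>cf_level 0\<close>.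
\<close>
primrec cf_level :: "nat \<Rightarrow> rat set" where
  "cf_level 0 = {0}"
| "cf_level (Suc n) = {x. 0 < x \<and> x < 1 \<and> gauss_map x \<in> cf_level n}"

lemma cf_level_unit: "x \<in> cf_level n \<Longrightarrow> of_rat x \<in> {0..1::real}"
  by (cases n) auto

lemma mem_cf_level_cf_length:
  assumes "0 < x" "x < 1"
  shows "x \<in> cf_level (cf_length x)"
proof -
  have step: "x \<in> cf_level (Suc n)"
    if "0 < x" "x < 1" "(gauss_map ^^ n) x > 0" "(gauss_map ^^ Suc n) x = 0" for n x
    using that
  proof (induction n arbitrary: x)
    case (Suc n)
    have "gauss_map x \<noteq> 0"
      using Suc.prems(3) by (auto simp: funpow_swap1)
    then have "gauss_map x \<in> cf_level (Suc n)"
      using Suc.prems gauss_map_bounds[of x] by (intro Suc.IH) (auto simp: funpow_swap1 less_le)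
    then show ?case using Suc.prems by simp
  qed simp
  have "1 \<le> cf_length x \<and> (gauss_map ^^ cf_length x) x = 0 \<and> (gauss_map ^^ (cf_length x - 1)) x > 0"
    unfolding cf_length_def by (rule theI'[OF ex1_cf_length[OF assms]])
  then show ?thesis using step[OF assms, of "cf_length x - 1"] by simp
qed

lemma gauss_map_inverse_branch:
  assumes "0 < x" "x < 1"
  defines "k \<equiv> nat \<lfloor>1 / x\<rfloor> - 1"
  shows "x = 1 / (of_nat k + 1 + gauss_map x)"
proof -
  have "1 / x \<ge> 1" using assms by simp
  then have "\<lfloor>1 / x\<rfloor> \<ge> 1" by (simp add: le_floor_iff)
  then have "int k + 1 = \<lfloor>1 / x\<rfloor>" unfolding k_def by linarith
  then have "(of_int (int k + 1) :: rat) = of_int \<lfloor>1 / x\<rfloor>" by (simp only:)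
  then have "of_nat k + 1 = (of_int \<lfloor>1 / x\<rfloor> :: rat)" by simp
  then have "of_nat k + 1 + gauss_map x = 1 / x"
    unfolding gauss_map_def frac_def by simp
  then show ?thesis by simp
qed

text \<open>
  Grouping the points of a level by their image \<open>y\<close> under the Gauss map, the inner sums run over distinct
  digits, and \<open>denom x = denom y * (k + 1 + y)\<close> factors out the power of \<open>denom y\<close>. Each level thus
  costs one application of \<open>sub\<close>.
\<close>
lemma cf_level_weighted_sum:
  fixes f :: "real \<Rightarrow> real"
  assumes sub: "\<And>x K. x \<in> {0..1} \<Longrightarrow> finite K \<Longrightarrow>
      (\<Sum>k\<in>K. (real k + 1 + x) powr e * f (1 / (real k + 1 + x))) \<le> \<Lambda> * f x"
    and \<Lambda>: "\<Lambda> \<ge> 0"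
    and A: "finite A" "A \<subseteq> cf_level n" and f0: "f 0 \<ge> 0"
  shows "(\<Sum>x\<in>A. real_of_int (denom x) powr e * f (of_rat x)) \<le> \<Lambda> ^ n * f 0"
  using A
proof (induction n arbitrary: A)
  case 0
  have "denom 0 = 1" by (simp add: denom_def)
  moreover have "A = {} \<or> A = {0}" using 0 by auto
  ultimately show ?case using f0 by auto
next
  case (Suc n)
  define F where "F = (\<lambda>x. real_of_int (denom x) powr e * f (of_rat x))"
  define dig where "dig = (\<lambda>x::rat. nat \<lfloor>1 / x\<rfloor> - 1)"
  have fiber: "(\<Sum>x | x \<in> A \<and> gauss_map x = y. F x) \<le> \<Lambda> * F y" if y: "y \<in> gauss_map ` A" for y
  proof -
    define S where "S = {x. x \<in> A \<and> gauss_map x = y}"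
    define r where "r = (of_rat y :: real)"
    have r: "r \<in> {0..1}" using y Suc.prems cf_level_unit[of y n] by (auto simp: r_def)
    have br: "x = 1 / (of_nat (dig x) + 1 + y)" if "x \<in> S" for x
      using that Suc.prems gauss_map_inverse_branch[of x] by (auto simp: S_def dig_def)
    have inj: "inj_on dig S" using br by (metis inj_onI)
    have Fx: "F x = real_of_int (denom y) powr e *
        ((real (dig x) + 1 + r) powr e * f (1 / (real (dig x) + 1 + r)))" if x: "x \<in> S" for x
    proof -
      have xr: "(of_rat x :: real) = 1 / (real (dig x) + 1 + r)"
        by (subst br[OF x]) (simp add: of_rat_divide of_rat_add r_def)
      have "of_int (denom y) = x * of_int (denom x)"
        using x Suc.prems denom_gauss_map[of x] by (auto simp: S_def)
      then have "(of_rat (of_int (denom y)) :: real) = of_rat (x * of_int (denom x))" by simp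
      then have "real_of_int (denom y) = 1 / (real (dig x) + 1 + r) * real_of_int (denom x)"
        by (simp add: of_rat_mult xr)
      then have "real_of_int (denom x) = real_of_int (denom y) * (real (dig x) + 1 + r)"
        using r by (simp add: field_simps)
      then show ?thesis
        unfolding F_def xr using r denom_pos[of y] by (simp add: powr_mult)
    qed
    have "(\<Sum>x\<in>S. F x) = real_of_int (denom y) powr e *
        (\<Sum>k\<in>dig ` S. (real k + 1 + r) powr e * f (1 / (real k + 1 + r)))"
      by (simp add: sum.reindex[OF inj] sum_distrib_left Fx)
    also have "\<dots> \<le> real_of_int (denom y) powr e * (\<Lambda> * f r)"
      using Suc.prems by (intro mult_left_mono sub r) (auto simp: S_def)
    finally show ?thesis by (simp add: S_def F_def r_def mult_ac)
  qed
  have "(\<Sum>x\<in>A. F x) = (\<Sum>y\<in>gauss_map ` A. \<Sum>x | x \<in> A \<and> gauss_map x = y. F x)"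
    by (rule sum.image_gen) fact
  also have "\<dots> \<le> (\<Sum>y\<in>gauss_map ` A. \<Lambda> * F y)"
    by (intro sum_mono fiber)
  also have "\<dots> = \<Lambda> * (\<Sum>y\<in>gauss_map ` A. F y)"
    by (simp add: sum_distrib_left)
  also have "\<dots> \<le> \<Lambda> * (\<Lambda> ^ n * f 0)"
    unfolding F_def using Suc.prems \<Lambda> by (intro mult_left_mono Suc.IH) auto
  finally show ?case by (simp add: F_def mult.assoc)
qed

lemma QQ_denom:
  assumes "x \<in> QQ q"
  shows "0 < x" "x < 1" "2 \<le> denom x" "denom x \<le> int q"
proof -
  obtain p r where pr: "x = of_nat p / of_nat r" "1 \<le> p" "p < r" "r \<le> q" "coprime p r"
    using assms by (auto simp: QQ_def)
  have "denom x = int r"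
    using denom_divide_coprime[of "int p" "int r"] pr by simp
  then show "0 < x" "x < 1" "2 \<le> denom x" "denom x \<le> int q" using pr by auto
qed

lemma card_strict_pairs:
  "2 * card (SIGMA r:{1..m}. {1..<r}) = m * (m - 1)"
proof -
  have "card (SIGMA r:{1..m}. {1..<r}) = (\<Sum>r=1..m. r - 1)" by (simp add: card_SigmaI)
  moreover have "2 * (\<Sum>r=1..m. r - 1) = m * (m - 1)"
  proof (induction m)
    case (Suc m)
    then show ?case by (cases m) simp_all
  qed simp
  ultimately show ?thesis by simp
qed

text \<open>
  The bound \<open>3/4\<close> is less than \<open>1\<close>, which is all that the sieve below requires.
\<close>
lemma sum_inverse_squares_from_two_le:
  "(\<Sum>d=2..n. 1 / (real d)\<^sup>2) \<le> 3/4"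
proof (cases "n \<ge> 2")
  case True
  then have "(\<Sum>d=2..n. 1 / (real d)\<^sup>2) \<le> 3/4 - 1 / real n"
  proof (induction n rule: dec_induct)
    case (step n)
    have "1 / (real (Suc n))\<^sup>2 \<le> 1 / (real n * real (Suc n))"
      unfolding power2_eq_square using step by (intro divide_left_mono mult_right_mono mult_pos_pos) auto
    also have "\<dots> = 1 / real n - 1 / real (Suc n)"
      using step by (simp add: field_simps)
    finally show ?case using step by simp
  qed simp
  also have "\<dots> \<le> 3/4" by simp
  finally show ?thesis .
qed simp

lemma finite_QQ: "finite (QQ q)"
proof -
  have "QQ q \<subseteq> (\<lambda>(r, p). of_nat p / of_nat r) ` ({..q} \<times> {..q})"
    by (force simp: QQ_def)
  then show ?thesis by (rule finite_subset) auto
qed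

text \<open>
  Among the roughly \<open>q\<^sup>2 / 2\<close> pairs \<open>p < r \<le> q\<close>, those with a common divisor \<open>d \<ge> 2\<close> number at most
  \<open>\<Sum>\<^sub>d (q / d)\<^sup>2 / 2 \<le> 3 q\<^sup>2 / 8\<close>.
\<close>
lemma Phi_lower_bound:
  assumes "q \<ge> 8"
  shows "real (Phi q) \<ge> (real q)\<^sup>2 / 16"
proof -
  define T where "T = (\<lambda>m::nat. SIGMA r:{1..m}. {1..<r})"
  define E where "E = {(r, p) \<in> T q. coprime p r}"
  have finT: "finite (T m)" for m by (auto simp: T_def)
  have cardT: "real (card (T m)) = real m * (real m - 1) / 2" for m
  proof -
    have "real (2 * card (T m)) = real (m * (m - 1))" using card_strict_pairs[of m] by (simp add: T_def)
    then have "2 * real (card (T m)) = real m * (real m - 1)" by (cases m) (auto simp: algebra_simps)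
    then show ?thesis by simp
  qed
  have "inj_on (\<lambda>(r, p). of_nat p / of_nat r :: rat) E"
  proof (rule inj_onI)
    fix a b assume "a \<in> E" "b \<in> E" and eq: "(\<lambda>(r, p). of_nat p / of_nat r :: rat) a = (\<lambda>(r, p). of_nat p / of_nat r) b"
    then obtain r p r' p' where ab: "a = (r, p)" "b = (r', p')" "r > 0" "r' > 0" "coprime p r" "coprime p' r'"
      by (auto simp: E_def T_def)
    have "int r = int r'"
      using denom_divide_coprime[of "int p" "int r"] denom_divide_coprime[of "int p'" "int r'"] eq ab by simp
    then show "a = b" using eq ab by simp
  qed
  moreover have "(\<lambda>(r, p). of_nat p / of_nat r) ` E = QQ q"
    by (force simp: E_def T_def QQ_def image_iff)
  ultimately have PhiE: "Phi q = card E"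
    unfolding Phi_def by (metis card_image)
  \<comment> \<open>Divide a pair that is not coprime by its greatest common divisor.\<close>
  have cover: "T q - E \<subseteq> (\<Union>d\<in>{2..q}. (\<lambda>(r, p). (d * r, d * p)) ` T (q div d))"
  proof
    fix a assume "a \<in> T q - E"
    moreover obtain r p where rp: "a = (r, p)" by (cases a)
    ultimately have a: "a = (r, p)" "1 \<le> p" "p < r" "r \<le> q" "\<not> coprime p r"
      by (auto simp: E_def T_def)
    define d where "d = gcd p r"
    have d0: "d > 0" using a by (simp add: d_def)
    have "d \<noteq> 1" using a(5) by (simp add: d_def coprime_iff_gcd_eq_1)
    moreover have "d \<le> r" using a by (auto simp: d_def intro: gcd_le2_nat)
    ultimately have d: "d \<in> {2..q}" using a d0 by auto
    obtain p' r' where pr: "p = d * p'" "r = d * r'"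
      by (metis d_def dvdE gcd_dvd1 gcd_dvd2)
    have "r' \<le> q div d" using a(4) pr d0 by (simp add: less_eq_div_iff_mult_less_eq mult.commute)
    then have "(r', p') \<in> T (q div d)" using a pr d0 by (auto simp: T_def)
    then have "a \<in> (\<lambda>(r, p). (d * r, d * p)) ` T (q div d)" using a pr by force
    then show "a \<in> (\<Union>d\<in>{2..q}. (\<lambda>(r, p). (d * r, d * p)) ` T (q div d))" using d by blast
  qed
  have "finite (\<Union>d\<in>{2..q}. (\<lambda>(r, p). (d * r, d * p)) ` T (q div d))"
    by (intro finite_UN_I finite_imageI finT) auto
  from card_mono[OF this cover]
  have "card (T q - E) \<le> (\<Sum>d=2..q. card ((\<lambda>(r, p). (d * r, d * p)) ` T (q div d)))"
    by (rule order_trans[OF _ card_UN_le[OF finite_atLeastAtMost]])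
  then have "real (card (T q - E)) \<le> real (\<Sum>d=2..q. card ((\<lambda>(r, p). (d * r, d * p)) ` T (q div d)))"
    by (simp only: of_nat_le_iff)
  also have "\<dots> \<le> (\<Sum>d=2..q. (real q)\<^sup>2 / 2 * (1 / (real d)\<^sup>2))"
    unfolding of_nat_sum
  proof (rule sum_mono)
    fix d assume "d \<in> {2..q}"
    have "real (card ((\<lambda>(r, p). (d * r, d * p)) ` T (q div d))) \<le> real (card (T (q div d)))"
      using card_image_le[OF finT] by simp
    also have "\<dots> \<le> (real (q div d))\<^sup>2 / 2"
      by (simp add: cardT power2_eq_square algebra_simps)
    also have "\<dots> \<le> (real q / real d)\<^sup>2 / 2"
      by (intro divide_right_mono power_mono of_nat_div_le_of_nat) auto
    finally show "real (card ((\<lambda>(r, p). (d * r, d * p)) ` T (q div d))) \<le> (real q)\<^sup>2 / 2 * (1 / (real d)\<^sup>2)"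
      by (simp add: power_divide)
  qed
  also have "\<dots> = (real q)\<^sup>2 / 2 * (\<Sum>d=2..q. 1 / (real d)\<^sup>2)"
    by (simp only: sum_distrib_left)
  also have "\<dots> \<le> (real q)\<^sup>2 / 2 * (3/4)"
    by (intro mult_left_mono sum_inverse_squares_from_two_le) auto
  finally have "real (card (T q - E)) \<le> 3/8 * (real q)\<^sup>2" by simp
  moreover have "card (T q) = card (T q - E) + card E"
  proof -
    have "E \<subseteq> T q" by (auto simp: E_def)
    then show ?thesis using finT by (metis card_Diff_subset card_mono finite_subset le_add_diff_inverse2)
  qed
  ultimately have "real (card E) \<ge> real q * (real q - 1) / 2 - 3/8 * (real q)\<^sup>2"
    using cardT[of q] by simp
  moreover have "real q * (real q - 1) / 2 - 3/8 * (real q)\<^sup>2 = (real q)\<^sup>2 / 16 + real q * (real q - 8) / 16"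
    by (simp add: power2_eq_square field_simps)
  moreover have "real q * (real q - 8) / 16 \<ge> 0" using assms by simp
  ultimately show ?thesis unfolding PhiE by linarith
qed

section \<open>Exponential tail bounds\<close>

text \<open>
  The function of \<open>perturbed_eigenfunction\<close> lies between \<open>1/4\<close> and \<open>3/2\<close>, and the constant \<open>6\<close> is the
  quotient of these bounds.
\<close>
lemma cf_level_denom_sum:
  assumes "\<eta> > 0"
  obtains t\<^sub>0 where "t\<^sub>0 > 0" and
    "\<And>t n A. \<bar>t\<bar> \<le> t\<^sub>0 \<Longrightarrow> finite A \<Longrightarrow> A \<subseteq> cf_level n \<Longrightarrow>
       (\<Sum>x\<in>A. real_of_int (denom x) powr (- 2 - 2 * t)) \<le> 6 * exp (- t * gk_entropy + \<eta> * \<bar>t\<bar>) ^ n"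
proof -
  obtain t\<^sub>0 where t0: "t\<^sub>0 > 0" and ex: "\<And>t. \<bar>t\<bar> \<le> t\<^sub>0 \<Longrightarrow> \<exists>f. (\<forall>x\<in>{0..1}. 1/4 \<le> f x \<and> f x \<le> 3/2) \<and>
       (\<forall>x\<in>{0..1}. \<forall>K. finite K \<longrightarrow>
          (\<Sum>k\<in>K. (real k + 1 + x) powr (- 2 - 2 * t) * f (1 / (real k + 1 + x)))
            \<le> exp (- t * gk_entropy + \<eta> * \<bar>t\<bar>) * f x)"
    by (rule perturbed_eigenfunction[OF assms]) blast
  show thesis
  proof (rule that[OF t0])
    fix t n A assume t: "\<bar>t\<bar> \<le> t\<^sub>0" and A: "finite A" "A \<subseteq> cf_level n"
    define \<Lambda> where "\<Lambda> = exp (- t * gk_entropy + \<eta> * \<bar>t\<bar>)"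
    obtain f where f: "\<And>x. x \<in> {0..1} \<Longrightarrow> 1/4 \<le> f x \<and> f x \<le> 3/2"
      and sub: "\<And>x K. x \<in> {0..1} \<Longrightarrow> finite K \<Longrightarrow>
        (\<Sum>k\<in>K. (real k + 1 + x) powr (- 2 - 2 * t) * f (1 / (real k + 1 + x))) \<le> \<Lambda> * f x"
      using ex[OF t] unfolding \<Lambda>_def by blast
    have f0: "0 \<le> f 0" "f 0 \<le> 3/2" using f[of 0] by auto
    have "(\<Sum>x\<in>A. real_of_int (denom x) powr (- 2 - 2 * t))
        \<le> (\<Sum>x\<in>A. 4 * (real_of_int (denom x) powr (- 2 - 2 * t) * f (of_rat x)))"
    proof (rule sum_mono)
      fix x assume "x \<in> A"
      then have "1/4 \<le> f (of_rat x)" using f cf_level_unit A by blast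
      then show "real_of_int (denom x) powr (- 2 - 2 * t) \<le> 4 * (real_of_int (denom x) powr (- 2 - 2 * t) * f (of_rat x))"
        using mult_left_mono[of "1/4" "f (of_rat x)" "real_of_int (denom x) powr (- 2 - 2 * t)"] by simp
    qed
    also have "\<dots> = 4 * (\<Sum>x\<in>A. real_of_int (denom x) powr (- 2 - 2 * t) * f (of_rat x))"
      by (simp only: sum_distrib_left)
    also have "\<dots> \<le> 4 * (\<Lambda> ^ n * f 0)"
      by (intro mult_left_mono cf_level_weighted_sum[OF sub _ A f0(1)]) (auto simp: \<Lambda>_def)
    also have "\<dots> \<le> 4 * (\<Lambda> ^ n * (3/2))"
      using f0 by (intro mult_left_mono) (auto simp: \<Lambda>_def)
    finally show "(\<Sum>x\<in>A. real_of_int (denom x) powr (- 2 - 2 * t)) \<le> 6 * \<Lambda> ^ n" by simp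
  qed
qed

text \<open>
  Both tails at once: \<open>t > 0\<close> serves long expansions and \<open>t < 0\<close> short ones. The exponent \<open>2 - 2 \<tau>\<close>
  arises from spending \<open>(q / r)\<^bsup>2-2\<tau>\<^esup> \<ge> 1\<close>, which absorbs small denominators into the same
  sum.
\<close>
lemma card_exponential_chebyshev:
  assumes level: "\<And>n A. finite A \<Longrightarrow> A \<subseteq> cf_level n \<Longrightarrow>
       (\<Sum>x\<in>A. real_of_int (denom x) powr (- 2 - 2 * t)) \<le> 6 * exp \<gamma> ^ n"
    and neg: "\<beta> + \<gamma> < 0" and \<tau>: "\<tau> \<le> 1"
    and A: "A \<subseteq> QQ q"
    and dev: "\<And>x. x \<in> A \<Longrightarrow> (t + \<tau>) * (2 * ln (real_of_int (denom x))) \<le> \<beta> * real (cf_length x)"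
  shows "real (card A) \<le> 6 / (1 - exp (\<beta> + \<gamma>)) * real q powr (2 - 2 * \<tau>)"
proof -
  define r where "r = (\<lambda>x. real_of_int (denom x))"
  have finA: "finite A" using finite_subset[OF A finite_QQ] .
  have r: "2 \<le> r x" "r x \<le> real q" "x \<in> cf_level (cf_length x)" if "x \<in> A" for x
    using QQ_denom[of x q] A that mem_cf_level_cf_length[of x] by (auto simp: r_def)
  have pointwise: "1 \<le> real q powr (2 - 2 * \<tau>) * (exp \<beta> ^ cf_length x * r x powr (- 2 - 2 * t))" if x: "x \<in> A" for x
  proof -
    have "1 = r x powr (2 - 2 * \<tau>) * (r x powr (2 * t + 2 * \<tau>) * r x powr (- 2 - 2 * t))"
      using r(1)[OF x] by (simp flip: powr_add)
    also have "\<dots> \<le> real q powr (2 - 2 * \<tau>) * (exp \<beta> ^ cf_length x * r x powr (- 2 - 2 * t))"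
    proof (intro mult_mono[OF powr_mono2 mult_right_mono])
      have "r x powr (2 * t + 2 * \<tau>) = exp ((t + \<tau>) * (2 * ln (r x)))"
        using r(1)[OF x] by (simp add: powr_def algebra_simps)
      also have "\<dots> \<le> exp (\<beta> * real (cf_length x))" using dev[OF x] by (simp add: r_def)
      also have "\<dots> = exp \<beta> ^ cf_length x"
        by (subst mult.commute) (rule exp_of_nat_mult)
      finally show "r x powr (2 * t + 2 * \<tau>) \<le> exp \<beta> ^ cf_length x" .
    qed (use \<tau> r[OF x] in auto)
    finally show ?thesis .
  qed
  have "(\<Sum>x\<in>A. exp \<beta> ^ cf_length x * r x powr (- 2 - 2 * t))
      = (\<Sum>n\<in>cf_length ` A. \<Sum>x | x \<in> A \<and> cf_length x = n. exp \<beta> ^ cf_length x * r x powr (- 2 - 2 * t))"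
    by (rule sum.image_gen[OF finA])
  also have "\<dots> = (\<Sum>n\<in>cf_length ` A. exp \<beta> ^ n * (\<Sum>x | x \<in> A \<and> cf_length x = n. r x powr (- 2 - 2 * t)))"
    unfolding sum_distrib_left by (intro sum.cong refl) auto
  also have "\<dots> \<le> (\<Sum>n\<in>cf_length ` A. exp \<beta> ^ n * (6 * exp \<gamma> ^ n))"
  proof (intro sum_mono mult_left_mono)
    fix n
    have "{x \<in> A. cf_length x = n} \<subseteq> cf_level n" using r(3) by auto
    from level[OF _ this]
    show "(\<Sum>x | x \<in> A \<and> cf_length x = n. r x powr (- 2 - 2 * t)) \<le> 6 * exp \<gamma> ^ n"
      using finA by (simp add: r_def)
  qed auto
  also have "\<dots> = (\<Sum>n\<in>cf_length ` A. 6 * exp (\<beta> + \<gamma>) ^ n)"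
    by (simp add: exp_add power_mult_distrib mult_ac)
  also have "\<dots> \<le> (\<Sum>n. 6 * exp (\<beta> + \<gamma>) ^ n)"
    using neg finA by (intro sum_le_suminf summable_mult summable_geometric) auto
  also have "\<dots> = 6 / (1 - exp (\<beta> + \<gamma>))"
    using neg by (subst suminf_mult) (auto simp: suminf_geometric)
  finally have inner: "(\<Sum>x\<in>A. exp \<beta> ^ cf_length x * r x powr (- 2 - 2 * t)) \<le> 6 / (1 - exp (\<beta> + \<gamma>))" .
  have "real (card A) = (\<Sum>x\<in>A. 1)" by simp
  also have "\<dots> \<le> (\<Sum>x\<in>A. real q powr (2 - 2 * \<tau>) * (exp \<beta> ^ cf_length x * r x powr (- 2 - 2 * t)))"
    by (intro sum_mono pointwise)
  also have "\<dots> = real q powr (2 - 2 * \<tau>) * (\<Sum>x\<in>A. exp \<beta> ^ cf_length x * r x powr (- 2 - 2 * t))"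
    by (simp only: sum_distrib_left)
  also have "\<dots> \<le> real q powr (2 - 2 * \<tau>) * (6 / (1 - exp (\<beta> + \<gamma>)))"
    by (intro mult_left_mono inner) auto
  finally show ?thesis by (simp add: mult.commute)
qed

text \<open>
  The exponential rate is \<open>(t + \<tau>) / c - t h + \<eta> t = \<tau> / c - t \<eta>\<close> when \<open>\<eta>\<close> is half of \<open>h - 1 / c\<close>.
\<close>
lemma long_expansions_rare:
  assumes a: "c > 0" "1 / c < gk_entropy"
  obtains C \<tau> where "\<tau> > 0"
    "\<And>q. real (card {x \<in> QQ q. c \<le> real (cf_length x) / (2 * ln (real_of_int (denom x)))}) \<le> C * real q powr (2 - 2 * \<tau>)"
proof -
  define \<eta> where "\<eta> = (gk_entropy - 1 / c) / 2"
  have \<eta>: "\<eta> > 0" using a by (simp add: \<eta>_def)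
  obtain t where t: "t > 0" and level: "\<And>n A. finite A \<Longrightarrow> A \<subseteq> cf_level n \<Longrightarrow>
       (\<Sum>x\<in>A. real_of_int (denom x) powr (- 2 - 2 * t)) \<le> 6 * exp (- t * gk_entropy + \<eta> * \<bar>t\<bar>) ^ n"
    using cf_level_denom_sum[OF \<eta>] by (metis abs_of_pos order_refl)
  define \<tau> where "\<tau> = min 1 (t * \<eta> * c / 2)"
  have \<tau>: "\<tau> > 0" "\<tau> \<le> 1" "\<tau> / c < t * \<eta>" using t \<eta> a by (auto simp: \<tau>_def min_def field_simps)
  have neg: "(t + \<tau>) / c + (- t * gk_entropy + \<eta> * \<bar>t\<bar>) < 0"
  proof -
    have h: "gk_entropy = 1 / c + 2 * \<eta>" using a by (simp add: \<eta>_def field_simps)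
    have "(t + \<tau>) / c + (- t * gk_entropy + \<eta> * \<bar>t\<bar>) = \<tau> / c - t * \<eta>"
      using t unfolding h by (simp add: add_divide_distrib algebra_simps)
    then show ?thesis using \<tau> by linarith
  qed
  show thesis
  proof (rule that[OF \<tau>(1)])
    fix q
    show "real (card {x \<in> QQ q. c \<le> real (cf_length x) / (2 * ln (real_of_int (denom x)))})
        \<le> 6 / (1 - exp ((t + \<tau>) / c + (- t * gk_entropy + \<eta> * \<bar>t\<bar>))) * real q powr (2 - 2 * \<tau>)"
    proof (rule card_exponential_chebyshev[OF level neg \<tau>(2)])
      fix x assume x: "x \<in> {x \<in> QQ q. c \<le> real (cf_length x) / (2 * ln (real_of_int (denom x)))}"
      then have "2 \<le> denom x" using QQ_denom[of x q] by simp
      then have "0 < 2 * ln (real_of_int (denom x))" by simp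
      then have "2 * ln (real_of_int (denom x)) \<le> real (cf_length x) / c"
        using x a by (simp add: field_simps)
      then have "(t + \<tau>) * (2 * ln (real_of_int (denom x))) \<le> (t + \<tau>) * (real (cf_length x) / c)"
        using t \<tau> by (intro mult_left_mono) auto
      then show "(t + \<tau>) * (2 * ln (real_of_int (denom x))) \<le> (t + \<tau>) / c * real (cf_length x)"
        by simp
    qed auto
  qed
qed

text \<open>
  The mirror image with \<open>t < 0\<close>; the extra condition \<open>\<tau> \<le> - t\<close> makes \<open>t + \<tau>\<close> nonpositive, so that
  the lower bound on \<open>2 ln r\<close> for short expansions bounds \<open>(t + \<tau>) (2 ln r)\<close> from above.
\<close>
lemma short_expansions_rare:
  assumes a: "c > 0" "1 / c > gk_entropy"
  obtains C \<tau> where "\<tau> > 0"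
    "\<And>q. real (card {x \<in> QQ q. real (cf_length x) / (2 * ln (real_of_int (denom x))) \<le> c}) \<le> C * real q powr (2 - 2 * \<tau>)"
proof -
  define \<eta> where "\<eta> = (1 / c - gk_entropy) / 2"
  have \<eta>: "\<eta> > 0" using a by (simp add: \<eta>_def)
  obtain t\<^sub>0 where t\<^sub>0: "t\<^sub>0 > 0" and level0: "\<And>t n A. \<bar>t\<bar> \<le> t\<^sub>0 \<Longrightarrow> finite A \<Longrightarrow> A \<subseteq> cf_level n \<Longrightarrow>
       (\<Sum>x\<in>A. real_of_int (denom x) powr (- 2 - 2 * t)) \<le> 6 * exp (- t * gk_entropy + \<eta> * \<bar>t\<bar>) ^ n"
    using cf_level_denom_sum[OF \<eta>] by metis
  define t where "t = - t\<^sub>0"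
  have t: "t < 0" using t\<^sub>0 by (simp add: t_def)
  have level: "(\<Sum>x\<in>A. real_of_int (denom x) powr (- 2 - 2 * t)) \<le> 6 * exp (- t * gk_entropy + \<eta> * \<bar>t\<bar>) ^ n"
    if "finite A" "A \<subseteq> cf_level n" for A n
    using level0[of t A n] that t\<^sub>0 by (simp add: t_def)
  define \<tau> where "\<tau> = min (min 1 (- t)) (- t * \<eta> * c / 2)"
  have \<tau>: "\<tau> > 0" "\<tau> \<le> 1" "\<tau> \<le> - t" "\<tau> / c < - t * \<eta>"
  proof -
    have "t * (\<eta> * c) < 0" using t \<eta> a by (intro mult_neg_pos) auto
    then have pos: "0 < - t * \<eta> * c / 2" by (simp add: mult.assoc)
    then show "\<tau> > 0" "\<tau> \<le> 1" "\<tau> \<le> - t" using t by (auto simp: \<tau>_def)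
    have "\<tau> \<le> - t * \<eta> * c / 2" by (simp add: \<tau>_def)
    also have "\<dots> < - t * \<eta> * c" using pos by linarith
    finally show "\<tau> / c < - t * \<eta>" using a by (simp add: pos_divide_less_eq)
  qed
  have neg: "(t + \<tau>) / c + (- t * gk_entropy + \<eta> * \<bar>t\<bar>) < 0"
  proof -
    have h: "gk_entropy = 1 / c - 2 * \<eta>" using a by (simp add: \<eta>_def field_simps)
    have "(t + \<tau>) / c + (- t * gk_entropy + \<eta> * \<bar>t\<bar>) = \<tau> / c + t * \<eta>"
      using t unfolding h by (simp add: add_divide_distrib algebra_simps)
    then show ?thesis using \<tau> by linarith
  qed
  show thesis
  proof (rule that[OF \<tau>(1)])
    fix q
    show "real (card {x \<in> QQ q. real (cf_length x) / (2 * ln (real_of_int (denom x))) \<le> c})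
        \<le> 6 / (1 - exp ((t + \<tau>) / c + (- t * gk_entropy + \<eta> * \<bar>t\<bar>))) * real q powr (2 - 2 * \<tau>)"
    proof (rule card_exponential_chebyshev[OF level neg \<tau>(2)])
      fix x assume x: "x \<in> {x \<in> QQ q. real (cf_length x) / (2 * ln (real_of_int (denom x))) \<le> c}"
      then have "2 \<le> denom x" using QQ_denom[of x q] by simp
      then have "0 < 2 * ln (real_of_int (denom x))" by simp
      then have "real (cf_length x) / c \<le> 2 * ln (real_of_int (denom x))"
        using x a by (simp add: field_simps)
      then have "(t + \<tau>) * (2 * ln (real_of_int (denom x))) \<le> (t + \<tau>) * (real (cf_length x) / c)"
        using \<tau> by (intro mult_left_mono_neg) auto
      then show "(t + \<tau>) * (2 * ln (real_of_int (denom x))) \<le> (t + \<tau>) / c * real (cf_length x)"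
        by simp
    qed auto
  qed
qed

theorem theorem1p7:
  "\<exists>\<epsilon>\<^sub>0 > 0. \<forall>\<epsilon>::real. 0 < \<epsilon> \<and> \<epsilon> < \<epsilon>\<^sub>0 \<longrightarrow>
    (\<exists>\<rho> > (0::real). \<forall>\<^sub>F q in sequentially.
      1 / real (Phi q) *
        real (card {x \<in> QQ q.
          \<bar>real (cf_length x) / (2 * ln (real_of_int (denom x))) - 6 * ln 2 / pi\<^sup>2\<bar> \<ge> \<epsilon>})
      \<le> real q powr (- 2 * \<rho>))"
proof -
  define c where "c = 6 * ln 2 / (pi\<^sup>2 :: real)"
  have c: "c > 0" by (simp add: c_def)
  have ent: "gk_entropy = 1 / c" by (simp add: gk_entropy_def c_def)
  define ratio where "ratio = (\<lambda>x. real (cf_length x) / (2 * ln (real_of_int (denom x))))"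
  have "\<exists>\<rho> > (0::real). \<forall>\<^sub>F q in sequentially.
      1 / real (Phi q) * real (card {x \<in> QQ q. \<bar>ratio x - c\<bar> \<ge> \<epsilon>}) \<le> real q powr (- 2 * \<rho>)"
    if \<epsilon>: "0 < \<epsilon>" "\<epsilon> < c" for \<epsilon>
  proof -
    obtain C\<^sub>1 \<tau>\<^sub>1 where up: "\<tau>\<^sub>1 > 0"
      "\<And>q. real (card {x \<in> QQ q. c + \<epsilon> \<le> ratio x}) \<le> C\<^sub>1 * real q powr (2 - 2 * \<tau>\<^sub>1)"
      unfolding ratio_def by (rule long_expansions_rare[of "c + \<epsilon>"])
        (use c \<epsilon> in \<open>auto simp: ent frac_less2\<close>)
    obtain C\<^sub>2 \<tau>\<^sub>2 where low: "\<tau>\<^sub>2 > 0"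
      "\<And>q. real (card {x \<in> QQ q. ratio x \<le> c - \<epsilon>}) \<le> C\<^sub>2 * real q powr (2 - 2 * \<tau>\<^sub>2)"
      unfolding ratio_def by (rule short_expansions_rare[of "c - \<epsilon>"])
        (use c \<epsilon> in \<open>auto simp: ent frac_less2\<close>)
    define \<rho> where "\<rho> = min \<tau>\<^sub>1 \<tau>\<^sub>2 / 2"
    define C where "C = \<bar>C\<^sub>1\<bar> + \<bar>C\<^sub>2\<bar>"
    have \<rho>: "\<rho> > 0" using up low by (simp add: \<rho>_def)
    have "filterlim (\<lambda>q. real q powr (2 * \<rho>)) at_top sequentially"
      using \<rho> by real_asymp
    then have "eventually (\<lambda>q. real q powr (2 * \<rho>) \<ge> 16 * C) sequentially"
      by (simp add: filterlim_at_top)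
    then have "\<forall>\<^sub>F q in sequentially.
      1 / real (Phi q) * real (card {x \<in> QQ q. \<bar>ratio x - c\<bar> \<ge> \<epsilon>}) \<le> real q powr (- 2 * \<rho>)"
      using eventually_ge_at_top[of 8]
    proof eventually_elim
      case (elim q)
      have q: "real q \<ge> 8" using elim by simp
      have "{x \<in> QQ q. \<bar>ratio x - c\<bar> \<ge> \<epsilon>} \<subseteq> {x \<in> QQ q. c + \<epsilon> \<le> ratio x} \<union> {x \<in> QQ q. ratio x \<le> c - \<epsilon>}"
        by auto
      then have "card {x \<in> QQ q. \<bar>ratio x - c\<bar> \<ge> \<epsilon>} \<le> card {x \<in> QQ q. c + \<epsilon> \<le> ratio x} + card {x \<in> QQ q. ratio x \<le> c - \<epsilon>}"
        using finite_QQ by (intro order_trans[OF card_mono card_Un_le]) auto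
      then have "real (card {x \<in> QQ q. \<bar>ratio x - c\<bar> \<ge> \<epsilon>})
          \<le> C\<^sub>1 * real q powr (2 - 2 * \<tau>\<^sub>1) + C\<^sub>2 * real q powr (2 - 2 * \<tau>\<^sub>2)"
        using up(2)[of q] low(2)[of q] by linarith
      also have "\<dots> \<le> \<bar>C\<^sub>1\<bar> * real q powr (2 - 4 * \<rho>) + \<bar>C\<^sub>2\<bar> * real q powr (2 - 4 * \<rho>)"
        using q by (intro add_mono mult_mono powr_mono) (auto simp: \<rho>_def)
      also have "\<dots> = C * real q powr (2 - 4 * \<rho>)" by (simp add: C_def algebra_simps)
      finally have bad: "real (card {x \<in> QQ q. \<bar>ratio x - c\<bar> \<ge> \<epsilon>}) \<le> C * real q powr (2 - 4 * \<rho>)" .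
      have Phi: "real (Phi q) \<ge> (real q)\<^sup>2 / 16" using Phi_lower_bound elim by simp
      moreover have "(real q)\<^sup>2 / 16 > 0" using q by simp
      ultimately have Phi_pos: "real (Phi q) > 0" by linarith
      have "1 / real (Phi q) * real (card {x \<in> QQ q. \<bar>ratio x - c\<bar> \<ge> \<epsilon>})
          \<le> 1 / ((real q)\<^sup>2 / 16) * (C * real q powr (2 - 4 * \<rho>))"
        using Phi Phi_pos bad q by (intro mult_mono divide_left_mono mult_pos_pos) auto
      also have "\<dots> = (16 * C) * (real q powr (2 - 4 * \<rho>) / real q powr 2)"
        using q by (simp add: powr_realpow)
      also have "\<dots> \<le> real q powr (2 * \<rho>) * (real q powr (2 - 4 * \<rho>) / real q powr 2)"
        using elim by (intro mult_right_mono) auto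
      also have "\<dots> = real q powr (2 * \<rho> + (2 - 4 * \<rho> - 2))" by (simp only: powr_diff powr_add)
      also have "2 * \<rho> + (2 - 4 * \<rho> - 2) = - 2 * \<rho>" by simp
      finally show ?case .
    qed
    then show ?thesis using \<rho> by blast
  qed
  then show ?thesis unfolding ratio_def c_def[symmetric] using c by blast
qed

end
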